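(* Let $G$ be a group and let $\mathcal{C}$ be a monoidal $G$-category. Let $\mathcal{C}(G)$ be the associated strict monoidal $G$-category (defined in the context), and let $U_e:\mathcal{C}(G)\to\mathcal{C}$ be the strict monoidal functor $(L,\eta)\mapsto L_e$, $f\mapsto f_e$. Then $U_e$, together with the natural isomorphisms $$\gamma(g)_{(L,\eta)}:=\eta_{g,e}:\ g_*(U_e(L,\eta))\to U_e(g_*(L,\eta)),\qquad g\in G,$$ is an equivalence of monoidal $G$-categories.
   Context: Convention: "monoidal category" means strict monoidal category; the unit object is denoted $\mathbf{1}$. A monoidal functor $(F,F_2,F_0):\mathcal{C}\to\mathcal{D}$ consists of a functor $F$, natural isomorphisms $F_2(X,Y):F(X\otimes Y)\to F(X)\otimes F(Y)$ and an isomorphism $F_0:F(\mathbf{1})\to\mathbf{1}$ satisfying $(F_2(X,Y)\otimes \mathrm{id}_{F(Z)})F_2(X\otimes Y,Z)=(\mathrm{id}_{F(X)}\otimes F_2(Y,Z))F_2(X,Y\otimes Z)$ and $(\mathrm{id}_{F(X)}\otimes F_0)F_2(X,\mathbf{1})=\mathrm{id}_{F(X)}=(F_0\otimes \mathrm{id}_{F(X)})F_2(\mathbf{1},X)$; it is strict if $F_2$ and $F_0$ are identities. Monoidal natural transformations are natural transformations compatible with $F_2$ and $F_0$. The composite $GF$ of monoidal functors has $(GF)_2(X,Y)=G_2(F(X),F(Y))\,G(F_2(X,Y))$ and $(GF)_0=G_0\,G(F_0)$. A monoidal $G$-category is a monoidal category $\mathcal{C}$ together with: functors $g_*:\mathcal{C}\to\mathcal{C}$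 for $g\in G$; natural isomorphisms $\phi(g,h):(gh)_*\to g_*\circ h_*$ for $g,h\in G$; natural isomorphisms $\psi^g(X,Y):g_*(X\otimes Y)\to g_*(X)\otimes g_*(Y)$ for $g\in G$; such that $g_*(\mathbf{1})=\mathbf{1}$, $\psi^g(X,\mathbf{1})=\psi^g(\mathbf{1},X)=\mathrm{id}_{g_*(X)}$, $e_*=\mathrm{Id}_{\mathcal{C}}$, $\phi(e,g)=\phi(g,e)=\mathrm{Id}_{g_*}$, and for all $g,h,k\in G$ and objects $X,Y,Z$: - $\phi(g,h)_{k_*(X)}\circ\phi(gh,k)_X=g_*(\phi(h,k)_X)\circ\phi(g,hk)_X$; - $(\psi^g(X,Y)\otimes \mathrm{id}_{g_*(Z)})\circ\psi^g(X\otimes Y,Z)=(\mathrm{id}_{g_*(X)}\otimes\psi^g(Y,Z))\circ\psi^g(X,Y\otimes Z)$; - $(\phi(g,h)_X\otimes\phi(g,h)_Y)\circ\psi^{gh}(X,Y)=\psi^g(h_*(X),h_*(Y))\circ g_*(\psi^h(X,Y))\circ\phi(g,h)_{X\otimes Y}$. It is strict if all $\psi^g$ and all $\phi(g,h)$ are identities. A monoidal $G$-functor $(F,\eta):\mathcal{C}\to\mathcal{D}$ between monoidal $G$-categories is a monoidal functor $F$ with monoidal natural isomorphisms $\eta(g):g_*\circ F\to F\circ g_*$ ($g\in G$) such that $\eta(e)=\mathrm{Id}_F$ and $F(\phi(g,h)_X)\circ\eta(gh)_X=\eta(g)_{h_*(X)}\circ g_*(\eta(h)_X)\circ\phi(g,h)_{F(X)}$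 for all $g,h\in G$ and all objects $X$. It is an equivalence of monoidal $G$-categories if $F$ is an equivalence of categories. The category $\mathcal{C}(G)$: objects are pairs $(L,\eta)$ with $L=\{L_g\}_{g\in G}$ a family of objects of $\mathcal{C}$ and $\eta=\{\eta_{g,h}:g_*(L_h)\to L_{gh}\}_{(g,h)\in G\times G}$ a family of isomorphisms such that $\eta_{e,g}=\mathrm{id}_{L_g}$ and $\eta_{gh,k}=\eta_{g,hk}\circ g_*(\eta_{h,k})\circ\phi(g,h)_{L_k}$ for all $g,h,k\in G$. A morphism $(L,\eta)\to(T,\chi)$ is a family $f=\{f_g:L_g\to T_g\}_{g\in G}$ of morphisms with $f_{gh}\circ\eta_{g,h}=\chi_{g,h}\circ g_*(f_h)$ for all $g,h$; composition is componentwise. Its (strict) tensor product is $(L,\eta)\otimes(L',\eta')=(LL',\eta\eta')$ with $(LL')_g=L_g\otimes L'_g$, $(\eta\eta')_{g,h}=(\eta_{g,h}\otimes\eta'_{g,h})\circ\psi^g(L_h,L'_h)$, $(f\otimes l)_g=f_g\otimes l_g$, and unit object the constant family $\mathbf{1}$ with identity isomorphisms. The strict $G$-action on $\mathcal{C}(G)$ is $g_*(L,\eta)=(gL,g\eta)$ with $(gL)_h=L_{hg}$, $(g\eta)_{x,y}=\eta_{x,yg}$, and $g_*(f)_h=f_{hg}$. *)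

theory Defs
  imports "HOL-Algebra.Group"
begin

section \<open>Categories, functors, natural transformations\<close>

record ('o, 'm) cat =
  Ob :: "'o set"
  Ar :: "'m set"
  Src :: "'m \<Rightarrow> 'o"
  Tgt :: "'m \<Rightarrow> 'o"
  Idn :: "'o \<Rightarrow> 'm"
  Cmp :: "'m \<Rightarrow> 'm \<Rightarrow> 'm"  (infixr "\<cdot>\<index>" 70)

definition Hom :: "('o, 'm, 'z) cat_scheme \<Rightarrow> 'o \<Rightarrow> 'o \<Rightarrow> 'm set" where
  "Hom C X Y = {f \<in> Ar C. Src C f = X \<and> Tgt C f = Y}"

text \<open>The composite \<open>g \<cdot> f\<close> is "first \<open>f\<close>, then \<open>g\<close>"; it is unconstrained when
  \<open>f\<close> and \<open>g\<close> are not composable.\<close>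

locale category =
  fixes C :: "('o, 'm, 'z) cat_scheme" (structure)
  assumes Src_Ob: "f \<in> Ar C \<Longrightarrow> Src C f \<in> Ob C"
    and Tgt_Ob: "f \<in> Ar C \<Longrightarrow> Tgt C f \<in> Ob C"
    and Idn_Hom: "X \<in> Ob C \<Longrightarrow> Idn C X \<in> Hom C X X"
    and Cmp_Hom: "\<lbrakk>f \<in> Hom C X Y; g \<in> Hom C Y Z\<rbrakk> \<Longrightarrow> g \<cdot> f \<in> Hom C X Z"
    and Cmp_Idn: "f \<in> Hom C X Y \<Longrightarrow> f \<cdot> Idn C X = f"
    and Idn_Cmp: "f \<in> Hom C X Y \<Longrightarrow> Idn C Y \<cdot> f = f"
    and Cmp_assoc: "\<lbrakk>f \<in> Hom C W X; g \<in> Hom C X Y; h \<in> Hom C Y Z\<rbrakk>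
      \<Longrightarrow> (h \<cdot> g) \<cdot> f = h \<cdot> (g \<cdot> f)"

definition Iso :: "('o, 'm, 'z) cat_scheme \<Rightarrow> 'o \<Rightarrow> 'o \<Rightarrow> 'm set" where
  "Iso C X Y = {f \<in> Hom C X Y. \<exists>g \<in> Hom C Y X.
     g \<cdot>\<^bsub>C\<^esub> f = Idn C X \<and> f \<cdot>\<^bsub>C\<^esub> g = Idn C Y}"

record ('o1, 'm1, 'o2, 'm2) fctr =
  ob_map :: "'o1 \<Rightarrow> 'o2"  (infixr "\<bullet>\<^sub>o" 90)
  ar_map :: "'m1 \<Rightarrow> 'm2"  (infixr "\<bullet>\<^sub>a" 90)

locale cat_functor = src: category C + tgt: category D
  for C :: "('o1, 'm1, 'y) cat_scheme" and D :: "('o2, 'm2, 'z) cat_scheme" +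
  fixes F :: "('o1, 'm1, 'o2, 'm2, 'w) fctr_scheme"
  assumes ob_map_Ob: "X \<in> Ob C \<Longrightarrow> F \<bullet>\<^sub>o X \<in> Ob D"
    and ar_map_Hom: "f \<in> Hom C X Y \<Longrightarrow> F \<bullet>\<^sub>a f \<in> Hom D (F \<bullet>\<^sub>o X) (F \<bullet>\<^sub>o Y)"
    and ar_map_Idn: "X \<in> Ob C \<Longrightarrow> F \<bullet>\<^sub>a Idn C X = Idn D (F \<bullet>\<^sub>o X)"
    and ar_map_Cmp: "\<lbrakk>f \<in> Hom C X Y; g \<in> Hom C Y Z\<rbrakk>
      \<Longrightarrow> F \<bullet>\<^sub>a (g \<cdot>\<^bsub>C\<^esub> f) = (F \<bullet>\<^sub>a g) \<cdot>\<^bsub>D\<^esub> (F \<bullet>\<^sub>a f)"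

definition Id_fctr :: "('o, 'm, 'o, 'm) fctr" where
  "Id_fctr = \<lparr>ob_map = (\<lambda>X. X), ar_map = (\<lambda>f. f)\<rparr>"

definition fctr_comp ::
  "('o2, 'm2, 'o3, 'm3, 'v) fctr_scheme \<Rightarrow> ('o1, 'm1, 'o2, 'm2, 'w) fctr_scheme
    \<Rightarrow> ('o1, 'm1, 'o3, 'm3) fctr" where
  "fctr_comp K F = \<lparr>ob_map = (\<lambda>X. K \<bullet>\<^sub>o F \<bullet>\<^sub>o X), ar_map = (\<lambda>f. K \<bullet>\<^sub>a F \<bullet>\<^sub>a f)\<rparr>"

locale nat_trans = F: cat_functor C D F + F': cat_functor C D F'
  for C :: "('o1, 'm1, 'y) cat_scheme" and D :: "('o2, 'm2, 'z) cat_scheme"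
    and F :: "('o1, 'm1, 'o2, 'm2, 'v) fctr_scheme"
    and F' :: "('o1, 'm1, 'o2, 'm2, 'w) fctr_scheme" +
  fixes \<tau> :: "'o1 \<Rightarrow> 'm2"
  assumes component: "X \<in> Ob C \<Longrightarrow> \<tau> X \<in> Hom D (F \<bullet>\<^sub>o X) (F' \<bullet>\<^sub>o X)"
    and naturality: "f \<in> Hom C X Y \<Longrightarrow> \<tau> Y \<cdot>\<^bsub>D\<^esub> (F \<bullet>\<^sub>a f) = (F' \<bullet>\<^sub>a f) \<cdot>\<^bsub>D\<^esub> \<tau> X"

locale nat_iso = nat_trans +
  assumes component_Iso: "X \<in> Ob C \<Longrightarrow> \<tau> X \<in> Iso D (F \<bullet>\<^sub>o X) (F' \<bullet>\<^sub>o X)"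

definition cat_equivalence ::
  "('o1, 'm1, 'y) cat_scheme \<Rightarrow> ('o2, 'm2, 'z) cat_scheme
    \<Rightarrow> ('o1, 'm1, 'o2, 'm2, 'w) fctr_scheme \<Rightarrow> bool" where
  "cat_equivalence C D F \<longleftrightarrow> cat_functor C D F \<and>
     (\<exists>(K :: ('o2, 'm2, 'o1, 'm1) fctr) \<alpha> \<beta>. cat_functor D C K \<and>
        nat_iso C C (fctr_comp K F) Id_fctr \<alpha> \<and> nat_iso D D (fctr_comp F K) Id_fctr \<beta>)"

section \<open>Strict monoidal categories and monoidal functors\<close>

record ('o, 'm) moncat = "('o, 'm) cat" +
  tens_ob :: "'o \<Rightarrow> 'o \<Rightarrow> 'o"  (infixr "\<boxtimes>\<^sub>o\<index>" 75)
  tens_ar :: "'m \<Rightarrow> 'm \<Rightarrow> 'm"  (infixr "\<boxtimes>\<^sub>a\<index>" 75)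
  unit_ob :: "'o"

locale monoidal_category = category C
  for C :: "('o, 'm, 'z) moncat_scheme" (structure) +
  assumes tens_ob_Ob: "\<lbrakk>X \<in> Ob C; Y \<in> Ob C\<rbrakk> \<Longrightarrow> X \<boxtimes>\<^sub>o Y \<in> Ob C"
    and tens_ar_Hom: "\<lbrakk>f \<in> Hom C X X'; g \<in> Hom C Y Y'\<rbrakk>
      \<Longrightarrow> f \<boxtimes>\<^sub>a g \<in> Hom C (X \<boxtimes>\<^sub>o Y) (X' \<boxtimes>\<^sub>o Y')"
    and tens_ar_Idn: "\<lbrakk>X \<in> Ob C; Y \<in> Ob C\<rbrakk> \<Longrightarrow> Idn C X \<boxtimes>\<^sub>a Idn C Y = Idn C (X \<boxtimes>\<^sub>o Y)"
    and tens_ar_Cmp: "\<lbrakk>f \<in> Hom C X X'; f' \<in> Hom C X' X''; g \<in> Hom C Y Y'; g' \<in> Hom C Y' Y''\<rbrakk>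
      \<Longrightarrow> (f' \<cdot> f) \<boxtimes>\<^sub>a (g' \<cdot> g) = (f' \<boxtimes>\<^sub>a g') \<cdot> (f \<boxtimes>\<^sub>a g)"
    and unit_ob_Ob: "unit_ob C \<in> Ob C"
    and tens_ob_assoc: "\<lbrakk>X \<in> Ob C; Y \<in> Ob C; Z \<in> Ob C\<rbrakk>
      \<Longrightarrow> (X \<boxtimes>\<^sub>o Y) \<boxtimes>\<^sub>o Z = X \<boxtimes>\<^sub>o (Y \<boxtimes>\<^sub>o Z)"
    and tens_ar_assoc: "\<lbrakk>f \<in> Ar C; g \<in> Ar C; h \<in> Ar C\<rbrakk>
      \<Longrightarrow> (f \<boxtimes>\<^sub>a g) \<boxtimes>\<^sub>a h = f \<boxtimes>\<^sub>a (g \<boxtimes>\<^sub>a h)"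
    and unit_tens_ob: "X \<in> Ob C \<Longrightarrow> unit_ob C \<boxtimes>\<^sub>o X = X"
    and tens_unit_ob: "X \<in> Ob C \<Longrightarrow> X \<boxtimes>\<^sub>o unit_ob C = X"
    and unit_tens_ar: "f \<in> Ar C \<Longrightarrow> Idn C (unit_ob C) \<boxtimes>\<^sub>a f = f"
    and tens_unit_ar: "f \<in> Ar C \<Longrightarrow> f \<boxtimes>\<^sub>a Idn C (unit_ob C) = f"

text \<open>A natural isomorphism \<open>\<tau> X Y : F(X \<otimes> Y) \<rightarrow> F(X) \<otimes> F(Y)\<close> of functors of two variables.\<close>

definition tens_nat_iso ::
  "('o1, 'm1, 'y) moncat_scheme \<Rightarrow> ('o2, 'm2, 'z) moncat_scheme
    \<Rightarrow> ('o1, 'm1, 'o2, 'm2, 'w) fctr_scheme \<Rightarrow> ('o1 \<Rightarrow> 'o1 \<Rightarrow> 'm2) \<Rightarrow> bool" where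
  "tens_nat_iso C D F \<tau> \<longleftrightarrow>
     (\<forall>X \<in> Ob C. \<forall>Y \<in> Ob C.
        \<tau> X Y \<in> Iso D (F \<bullet>\<^sub>o (X \<boxtimes>\<^sub>o\<^bsub>C\<^esub> Y)) ((F \<bullet>\<^sub>o X) \<boxtimes>\<^sub>o\<^bsub>D\<^esub> (F \<bullet>\<^sub>o Y))) \<and>
     (\<forall>X X' Y Y'. \<forall>f \<in> Hom C X X'. \<forall>g \<in> Hom C Y Y'.
        \<tau> X' Y' \<cdot>\<^bsub>D\<^esub> (F \<bullet>\<^sub>a (f \<boxtimes>\<^sub>a\<^bsub>C\<^esub> g)) = ((F \<bullet>\<^sub>a f) \<boxtimes>\<^sub>a\<^bsub>D\<^esub> (F \<bullet>\<^sub>a g)) \<cdot>\<^bsub>D\<^esub> \<tau> X Y)"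

record ('o1, 'm1, 'o2, 'm2) mon_fctr = "('o1, 'm1, 'o2, 'm2) fctr" +
  fctr2 :: "'o1 \<Rightarrow> 'o1 \<Rightarrow> 'm2"
  fctr0 :: "'m2"

locale monoidal_functor = cat_functor C D F + src: monoidal_category C + tgt: monoidal_category D
  for C :: "('o1, 'm1, 'y) moncat_scheme" and D :: "('o2, 'm2, 'z) moncat_scheme"
    and F :: "('o1, 'm1, 'o2, 'm2, 'w) mon_fctr_scheme" +
  assumes fctr2_nat_iso: "tens_nat_iso C D F (fctr2 F)"
    and fctr0_Iso: "fctr0 F \<in> Iso D (F \<bullet>\<^sub>o unit_ob C) (unit_ob D)"
    and fctr2_assoc: "\<lbrakk>X \<in> Ob C; Y \<in> Ob C; Z \<in> Ob C\<rbrakk> \<Longrightarrow>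
      (fctr2 F X Y \<boxtimes>\<^sub>a\<^bsub>D\<^esub> Idn D (F \<bullet>\<^sub>o Z)) \<cdot>\<^bsub>D\<^esub> fctr2 F (X \<boxtimes>\<^sub>o\<^bsub>C\<^esub> Y) Z =
      (Idn D (F \<bullet>\<^sub>o X) \<boxtimes>\<^sub>a\<^bsub>D\<^esub> fctr2 F Y Z) \<cdot>\<^bsub>D\<^esub> fctr2 F X (Y \<boxtimes>\<^sub>o\<^bsub>C\<^esub> Z)"
    and fctr2_unit_right: "X \<in> Ob C \<Longrightarrow>
      (Idn D (F \<bullet>\<^sub>o X) \<boxtimes>\<^sub>a\<^bsub>D\<^esub> fctr0 F) \<cdot>\<^bsub>D\<^esub> fctr2 F X (unit_ob C) = Idn D (F \<bullet>\<^sub>o X)"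
    and fctr2_unit_left: "X \<in> Ob C \<Longrightarrow>
      (fctr0 F \<boxtimes>\<^sub>a\<^bsub>D\<^esub> Idn D (F \<bullet>\<^sub>o X)) \<cdot>\<^bsub>D\<^esub> fctr2 F (unit_ob C) X = Idn D (F \<bullet>\<^sub>o X)"

text \<open>An identity arrow determines its source and target, so the two equations below contain
  \<open>F(X \<otimes> Y) = F(X) \<otimes> F(Y)\<close> and \<open>F(\<one>) = \<one>\<close>. The same remark applies to the strictness
  conditions on \<open>\<psi>\<close> and \<open>\<phi>\<close> further down.\<close>

locale strict_monoidal_functor = monoidal_functor +
  assumes fctr2_strict: "\<lbrakk>X \<in> Ob C; Y \<in> Ob C\<rbrakk> \<Longrightarrow> fctr2 F X Y = Idn D (F \<bullet>\<^sub>o (X \<boxtimes>\<^sub>o\<^bsub>C\<^esub> Y))"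
    and fctr0_strict: "fctr0 F = Idn D (F \<bullet>\<^sub>o unit_ob C)"

text \<open>In \<open>mon_fctr_comp E K F\<close>, \<open>E\<close> is the target category of \<open>K\<close>.\<close>

definition mon_fctr_comp ::
  "('o3, 'm3, 'z) cat_scheme \<Rightarrow> ('o2, 'm2, 'o3, 'm3, 'v) mon_fctr_scheme
    \<Rightarrow> ('o1, 'm1, 'o2, 'm2, 'w) mon_fctr_scheme \<Rightarrow> ('o1, 'm1, 'o3, 'm3) mon_fctr" where
  "mon_fctr_comp E K F =
     \<lparr>ob_map = (\<lambda>X. K \<bullet>\<^sub>o F \<bullet>\<^sub>o X),
      ar_map = (\<lambda>f. K \<bullet>\<^sub>a F \<bullet>\<^sub>a f),
      fctr2 = (\<lambda>X Y. fctr2 K (F \<bullet>\<^sub>o X) (F \<bullet>\<^sub>o Y) \<cdot>\<^bsub>E\<^esub> (K \<bullet>\<^sub>a fctr2 F X Y)),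
      fctr0 = fctr0 K \<cdot>\<^bsub>E\<^esub> (K \<bullet>\<^sub>a fctr0 F)\<rparr>"

locale monoidal_nat_trans =
  nat_trans C D F F' \<tau> + F: monoidal_functor C D F + F': monoidal_functor C D F'
  for C :: "('o1, 'm1, 'y) moncat_scheme" and D :: "('o2, 'm2, 'z) moncat_scheme"
    and F :: "('o1, 'm1, 'o2, 'm2, 'v) mon_fctr_scheme"
    and F' :: "('o1, 'm1, 'o2, 'm2, 'w) mon_fctr_scheme" and \<tau> :: "'o1 \<Rightarrow> 'm2" +
  assumes compatible2: "\<lbrakk>X \<in> Ob C; Y \<in> Ob C\<rbrakk> \<Longrightarrow>
      fctr2 F' X Y \<cdot>\<^bsub>D\<^esub> \<tau> (X \<boxtimes>\<^sub>o\<^bsub>C\<^esub> Y) = (\<tau> X \<boxtimes>\<^sub>a\<^bsub>D\<^esub> \<tau> Y) \<cdot>\<^bsub>D\<^esub> fctr2 F X Y"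
    and compatible0: "fctr0 F' \<cdot>\<^bsub>D\<^esub> \<tau> (unit_ob C) = fctr0 F"

locale monoidal_nat_iso = monoidal_nat_trans + nat_iso

section \<open>Monoidal \<open>G\<close>-categories\<close>

record ('o, 'm, 'g) gcat = "('o, 'm) moncat" +
  act :: "'g \<Rightarrow> ('o, 'm, 'o, 'm) fctr"
  phi :: "'g \<Rightarrow> 'g \<Rightarrow> 'o \<Rightarrow> 'm"
  psi :: "'g \<Rightarrow> 'o \<Rightarrow> 'o \<Rightarrow> 'm"

locale monoidal_G_category = group G + monoidal_category C
  for G :: "('g, 'b) monoid_scheme" and C :: "('o, 'm, 'g, 'z) gcat_scheme" +
  assumes act_functor: "g \<in> carrier G \<Longrightarrow> cat_functor C C (act C g)"
    and phi_nat_iso: "\<lbrakk>g \<in> carrier G; h \<in> carrier G\<rbrakk> \<Longrightarrow>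
      nat_iso C C (act C (g \<otimes>\<^bsub>G\<^esub> h)) (fctr_comp (act C g) (act C h)) (phi C g h)"
    and psi_nat_iso: "g \<in> carrier G \<Longrightarrow> tens_nat_iso C C (act C g) (psi C g)"
    and act_unit: "g \<in> carrier G \<Longrightarrow> act C g \<bullet>\<^sub>o unit_ob C = unit_ob C"
    and psi_unit_right: "\<lbrakk>g \<in> carrier G; X \<in> Ob C\<rbrakk> \<Longrightarrow>
      psi C g X (unit_ob C) = Idn C (act C g \<bullet>\<^sub>o X)"
    and psi_unit_left: "\<lbrakk>g \<in> carrier G; X \<in> Ob C\<rbrakk> \<Longrightarrow>
      psi C g (unit_ob C) X = Idn C (act C g \<bullet>\<^sub>o X)"
    and act_one_ob: "X \<in> Ob C \<Longrightarrow> act C \<one>\<^bsub>G\<^esub> \<bullet>\<^sub>o X = X"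
    and act_one_ar: "f \<in> Ar C \<Longrightarrow> act C \<one>\<^bsub>G\<^esub> \<bullet>\<^sub>a f = f"
    and phi_one_left: "\<lbrakk>g \<in> carrier G; X \<in> Ob C\<rbrakk> \<Longrightarrow>
      phi C \<one>\<^bsub>G\<^esub> g X = Idn C (act C g \<bullet>\<^sub>o X)"
    and phi_one_right: "\<lbrakk>g \<in> carrier G; X \<in> Ob C\<rbrakk> \<Longrightarrow>
      phi C g \<one>\<^bsub>G\<^esub> X = Idn C (act C g \<bullet>\<^sub>o X)"
    and phi_phi: "\<lbrakk>g \<in> carrier G; h \<in> carrier G; k \<in> carrier G; X \<in> Ob C\<rbrakk> \<Longrightarrow>
      phi C g h (act C k \<bullet>\<^sub>o X) \<cdot>\<^bsub>C\<^esub> phi C (g \<otimes>\<^bsub>G\<^esub> h) k X =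
      (act C g \<bullet>\<^sub>a phi C h k X) \<cdot>\<^bsub>C\<^esub> phi C g (h \<otimes>\<^bsub>G\<^esub> k) X"
    and psi_psi: "\<lbrakk>g \<in> carrier G; X \<in> Ob C; Y \<in> Ob C; Z \<in> Ob C\<rbrakk> \<Longrightarrow>
      (psi C g X Y \<boxtimes>\<^sub>a\<^bsub>C\<^esub> Idn C (act C g \<bullet>\<^sub>o Z)) \<cdot>\<^bsub>C\<^esub> psi C g (X \<boxtimes>\<^sub>o\<^bsub>C\<^esub> Y) Z =
      (Idn C (act C g \<bullet>\<^sub>o X) \<boxtimes>\<^sub>a\<^bsub>C\<^esub> psi C g Y Z) \<cdot>\<^bsub>C\<^esub> psi C g X (Y \<boxtimes>\<^sub>o\<^bsub>C\<^esub> Z)"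
    and phi_psi: "\<lbrakk>g \<in> carrier G; h \<in> carrier G; X \<in> Ob C; Y \<in> Ob C\<rbrakk> \<Longrightarrow>
      (phi C g h X \<boxtimes>\<^sub>a\<^bsub>C\<^esub> phi C g h Y) \<cdot>\<^bsub>C\<^esub> psi C (g \<otimes>\<^bsub>G\<^esub> h) X Y =
      psi C g (act C h \<bullet>\<^sub>o X) (act C h \<bullet>\<^sub>o Y) \<cdot>\<^bsub>C\<^esub>
        ((act C g \<bullet>\<^sub>a psi C h X Y) \<cdot>\<^bsub>C\<^esub> phi C g h (X \<boxtimes>\<^sub>o\<^bsub>C\<^esub> Y))"

locale strict_monoidal_G_category = monoidal_G_category +
  assumes psi_strict: "\<lbrakk>g \<in> carrier G; X \<in> Ob C; Y \<in> Ob C\<rbrakk> \<Longrightarrow>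
      psi C g X Y = Idn C (act C g \<bullet>\<^sub>o (X \<boxtimes>\<^sub>o\<^bsub>C\<^esub> Y))"
    and phi_strict: "\<lbrakk>g \<in> carrier G; h \<in> carrier G; X \<in> Ob C\<rbrakk> \<Longrightarrow>
      phi C g h X = Idn C (act C (g \<otimes>\<^bsub>G\<^esub> h) \<bullet>\<^sub>o X)"

text \<open>Since \<open>g\<^sub>*(\<one>) = \<one>\<close>, the functor \<open>g\<^sub>*\<close> is monoidal with \<open>(g\<^sub>*)\<^sub>2 = \<psi>\<^sup>g\<close> and
  \<open>(g\<^sub>*)\<^sub>0\<close> the identity of \<open>\<one>\<close>. This is the monoidal structure with respect to which the
  transformations \<open>\<eta> g\<close> of a monoidal \<open>G\<close>-functor are monoidal.\<close>

definition mon_act :: "('o, 'm, 'g, 'z) gcat_scheme \<Rightarrow> 'g \<Rightarrow> ('o, 'm, 'o, 'm) mon_fctr" where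
  "mon_act C g =
     \<lparr>ob_map = ob_map (act C g), ar_map = ar_map (act C g),
      fctr2 = psi C g, fctr0 = Idn C (unit_ob C)\<rparr>"

locale monoidal_G_functor =
  src: monoidal_G_category G C + tgt: monoidal_G_category G D + monoidal_functor C D F
  for G :: "('g, 'b) monoid_scheme"
    and C :: "('o1, 'm1, 'g, 'y) gcat_scheme" and D :: "('o2, 'm2, 'g, 'z) gcat_scheme"
    and F :: "('o1, 'm1, 'o2, 'm2, 'w) mon_fctr_scheme" +
  fixes \<eta> :: "'g \<Rightarrow> 'o1 \<Rightarrow> 'm2"
  assumes eta_monoidal_nat_iso: "g \<in> carrier G \<Longrightarrow>
      monoidal_nat_iso C D (mon_fctr_comp D (mon_act D g) F) (mon_fctr_comp D F (mon_act C g)) (\<eta> g)"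
    and eta_one: "X \<in> Ob C \<Longrightarrow> \<eta> \<one>\<^bsub>G\<^esub> X = Idn D (F \<bullet>\<^sub>o X)"
    and eta_mult: "\<lbrakk>g \<in> carrier G; h \<in> carrier G; X \<in> Ob C\<rbrakk> \<Longrightarrow>
      (F \<bullet>\<^sub>a phi C g h X) \<cdot>\<^bsub>D\<^esub> \<eta> (g \<otimes>\<^bsub>G\<^esub> h) X =
      \<eta> g (act C h \<bullet>\<^sub>o X) \<cdot>\<^bsub>D\<^esub> ((act D g \<bullet>\<^sub>a \<eta> h X) \<cdot>\<^bsub>D\<^esub> phi D g h (F \<bullet>\<^sub>o X))"

locale monoidal_G_equivalence = monoidal_G_functor +
  assumes equivalence: "cat_equivalence C D F"

section \<open>The category \<open>C(G)\<close>\<close>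

text \<open>Families indexed by \<open>G\<close> (or \<open>G \<times> G\<close>) are functions that are \<^const>\<open>extensional\<close> on the
  carrier, so that equality of functions is equality of families. A family \<open>f\<close> of arrows does not
  determine the structure isomorphisms of its source and target, so an arrow of \<open>C(G)\<close> is a
  triple (source, target, family).\<close>

type_synonym ('o, 'm, 'g) CG_ob = "('g \<Rightarrow> 'o) \<times> ('g \<times> 'g \<Rightarrow> 'm)"
type_synonym ('o, 'm, 'g) CG_ar = "('o, 'm, 'g) CG_ob \<times> ('o, 'm, 'g) CG_ob \<times> ('g \<Rightarrow> 'm)"

definition CG_Ob :: "('g, 'b) monoid_scheme \<Rightarrow> ('o, 'm, 'g, 'z) gcat_scheme
    \<Rightarrow> ('o, 'm, 'g) CG_ob set" where
  "CG_Ob G C = {(L, \<eta>).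
     L \<in> extensional (carrier G) \<and> \<eta> \<in> extensional (carrier G \<times> carrier G) \<and>
     (\<forall>g \<in> carrier G. L g \<in> Ob C) \<and>
     (\<forall>g \<in> carrier G. \<forall>h \<in> carrier G. \<eta> (g, h) \<in> Iso C (act C g \<bullet>\<^sub>o L h) (L (g \<otimes>\<^bsub>G\<^esub> h))) \<and>
     (\<forall>g \<in> carrier G. \<eta> (\<one>\<^bsub>G\<^esub>, g) = Idn C (L g)) \<and>
     (\<forall>g \<in> carrier G. \<forall>h \<in> carrier G. \<forall>k \<in> carrier G.
        \<eta> (g \<otimes>\<^bsub>G\<^esub> h, k) =
        \<eta> (g, h \<otimes>\<^bsub>G\<^esub> k) \<cdot>\<^bsub>C\<^esub> ((act C g \<bullet>\<^sub>a \<eta> (h, k)) \<cdot>\<^bsub>C\<^esub> phi C g h (L k)))}"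

definition CG_Ar :: "('g, 'b) monoid_scheme \<Rightarrow> ('o, 'm, 'g, 'z) gcat_scheme
    \<Rightarrow> ('o, 'm, 'g) CG_ar set" where
  "CG_Ar G C = {((L, \<eta>), (T, \<chi>), f).
     (L, \<eta>) \<in> CG_Ob G C \<and> (T, \<chi>) \<in> CG_Ob G C \<and> f \<in> extensional (carrier G) \<and>
     (\<forall>g \<in> carrier G. f g \<in> Hom C (L g) (T g)) \<and>
     (\<forall>g \<in> carrier G. \<forall>h \<in> carrier G.
        f (g \<otimes>\<^bsub>G\<^esub> h) \<cdot>\<^bsub>C\<^esub> \<eta> (g, h) = \<chi> (g, h) \<cdot>\<^bsub>C\<^esub> (act C g \<bullet>\<^sub>a f h))}"

definition CG_Idn :: "('g, 'b) monoid_scheme \<Rightarrow> ('o, 'm, 'g, 'z) gcat_scheme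
    \<Rightarrow> ('o, 'm, 'g) CG_ob \<Rightarrow> ('o, 'm, 'g) CG_ar" where
  "CG_Idn G C = (\<lambda>(L, \<eta>). ((L, \<eta>), (L, \<eta>), \<lambda>g \<in> carrier G. Idn C (L g)))"

definition CG_Cmp :: "('g, 'b) monoid_scheme \<Rightarrow> ('o, 'm, 'g, 'z) gcat_scheme
    \<Rightarrow> ('o, 'm, 'g) CG_ar \<Rightarrow> ('o, 'm, 'g) CG_ar \<Rightarrow> ('o, 'm, 'g) CG_ar" where
  "CG_Cmp G C = (\<lambda>(_, Z, f') (X, _, f). (X, Z, \<lambda>g \<in> carrier G. f' g \<cdot>\<^bsub>C\<^esub> f g))"

definition CG_tens_ob :: "('g, 'b) monoid_scheme \<Rightarrow> ('o, 'm, 'g, 'z) gcat_scheme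
    \<Rightarrow> ('o, 'm, 'g) CG_ob \<Rightarrow> ('o, 'm, 'g) CG_ob \<Rightarrow> ('o, 'm, 'g) CG_ob" where
  "CG_tens_ob G C = (\<lambda>(L, \<eta>) (L', \<eta>').
     (\<lambda>g \<in> carrier G. L g \<boxtimes>\<^sub>o\<^bsub>C\<^esub> L' g,
      \<lambda>(g, h) \<in> carrier G \<times> carrier G.
        (\<eta> (g, h) \<boxtimes>\<^sub>a\<^bsub>C\<^esub> \<eta>' (g, h)) \<cdot>\<^bsub>C\<^esub> psi C g (L h) (L' h)))"

definition CG_tens_ar :: "('g, 'b) monoid_scheme \<Rightarrow> ('o, 'm, 'g, 'z) gcat_scheme
    \<Rightarrow> ('o, 'm, 'g) CG_ar \<Rightarrow> ('o, 'm, 'g) CG_ar \<Rightarrow> ('o, 'm, 'g) CG_ar" where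
  "CG_tens_ar G C = (\<lambda>(X, Y, f) (X', Y', l).
     (CG_tens_ob G C X X', CG_tens_ob G C Y Y', \<lambda>g \<in> carrier G. f g \<boxtimes>\<^sub>a\<^bsub>C\<^esub> l g))"

definition CG_unit :: "('g, 'b) monoid_scheme \<Rightarrow> ('o, 'm, 'g, 'z) gcat_scheme
    \<Rightarrow> ('o, 'm, 'g) CG_ob" where
  "CG_unit G C =
     (\<lambda>g \<in> carrier G. unit_ob C, \<lambda>(g, h) \<in> carrier G \<times> carrier G. Idn C (unit_ob C))"

definition CG_act_ob :: "('g, 'b) monoid_scheme \<Rightarrow> 'g
    \<Rightarrow> ('o, 'm, 'g) CG_ob \<Rightarrow> ('o, 'm, 'g) CG_ob" where
  "CG_act_ob G g = (\<lambda>(L, \<eta>).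
     (\<lambda>h \<in> carrier G. L (h \<otimes>\<^bsub>G\<^esub> g),
      \<lambda>(x, y) \<in> carrier G \<times> carrier G. \<eta> (x, y \<otimes>\<^bsub>G\<^esub> g)))"

definition CG_act_ar :: "('g, 'b) monoid_scheme \<Rightarrow> 'g
    \<Rightarrow> ('o, 'm, 'g) CG_ar \<Rightarrow> ('o, 'm, 'g) CG_ar" where
  "CG_act_ar G g = (\<lambda>(X, Y, f).
     (CG_act_ob G g X, CG_act_ob G g Y, \<lambda>h \<in> carrier G. f (h \<otimes>\<^bsub>G\<^esub> g)))"

definition CG :: "('g, 'b) monoid_scheme \<Rightarrow> ('o, 'm, 'g, 'z) gcat_scheme
    \<Rightarrow> (('o, 'm, 'g) CG_ob, ('o, 'm, 'g) CG_ar, 'g) gcat" where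
  "CG G C =
     \<lparr>Ob = CG_Ob G C,
      Ar = CG_Ar G C,
      Src = (\<lambda>(X, Y, f). X),
      Tgt = (\<lambda>(X, Y, f). Y),
      Idn = CG_Idn G C,
      Cmp = CG_Cmp G C,
      tens_ob = CG_tens_ob G C,
      tens_ar = CG_tens_ar G C,
      unit_ob = CG_unit G C,
      act = (\<lambda>g. \<lparr>ob_map = CG_act_ob G g, ar_map = CG_act_ar G g\<rparr>),
      phi = (\<lambda>g h X. CG_Idn G C (CG_act_ob G (g \<otimes>\<^bsub>G\<^esub> h) X)),
      psi = (\<lambda>g X Y. CG_Idn G C (CG_act_ob G g (CG_tens_ob G C X Y)))\<rparr>"

definition U_e :: "('g, 'b) monoid_scheme \<Rightarrow> ('o, 'm, 'g, 'z) gcat_scheme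
    \<Rightarrow> (('o, 'm, 'g) CG_ob, ('o, 'm, 'g) CG_ar, 'o, 'm) mon_fctr" where
  "U_e G C =
     \<lparr>ob_map = (\<lambda>(L, \<eta>). L \<one>\<^bsub>G\<^esub>),
      ar_map = (\<lambda>(X, Y, f). f \<one>\<^bsub>G\<^esub>),
      fctr2 = (\<lambda>(L, \<eta>) (L', \<eta>'). Idn C (L \<one>\<^bsub>G\<^esub> \<boxtimes>\<^sub>o\<^bsub>C\<^esub> L' \<one>\<^bsub>G\<^esub>)),
      fctr0 = Idn C (unit_ob C)\<rparr>"

definition gamma :: "('g, 'b) monoid_scheme \<Rightarrow> 'g \<Rightarrow> ('o, 'm, 'g) CG_ob \<Rightarrow> 'm" where
  "gamma G g = (\<lambda>(L, \<eta>). \<eta> (g, \<one>\<^bsub>G\<^esub>))"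

end

theory Submission
  imports Defs
begin

text \<open>
  An object of \<open>C(G)\<close> is a family \<open>L\<close> in which each \<open>L\<^sub>g\<close> comes with an isomorphism
  \<open>\<eta>\<^sub>g\<^sub>,\<^sub>e : g\<^sub>*(L\<^sub>e) \<rightarrow> L\<^sub>g\<close>. So \<open>L\<close> is, up to isomorphism, the orbit \<open>g \<mapsto> g\<^sub>*(L\<^sub>e)\<close> of its value at the
  unit, while the action on \<open>C(G)\<close> is a mere translation of indices and hence strict: the
  non-strictness of \<open>C\<close> is absorbed by the structure isomorphisms.

  That \<open>C(G)\<close> is a strict monoidal \<open>G\<close>-category mirrors the axioms of \<open>C\<close>. The axiom relating
  \<open>\<phi>\<close> and \<open>\<psi>\<close> makes \<open>\<eta>\<eta>'\<close> satisfy the cocycle condition (\<open>CG_tens_Ob\<close>), and the associativity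
  axiom of \<open>\<psi>\<close> makes the tensor product strictly associative (\<open>CG_tens_assoc\<close>). Two normalisations
  have to be derived: \<open>\<psi>\<^sup>e = id\<close>, so that \<open>\<eta>\<eta>'\<close> is again the identity at \<open>(e, g)\<close>, and
  \<open>\<phi>(g, h)\<^sub>\<one> = id\<close>, so that the constant family \<open>\<one>\<close> satisfies the cocycle condition. In both cases
  the axioms show the arrow to be idempotent, and an idempotent isomorphism is an identity
  (\<open>psi_one\<close>, \<open>phi_unit\<close>).

  For \<open>\<gamma>(g) = \<eta>\<^sub>g\<^sub>,\<^sub>e\<close>, naturality is the condition on arrows of \<open>C(G)\<close> at \<open>(g, e)\<close>, compatibility with
  tensor products is the definition of \<open>\<eta>\<eta>'\<close>, and the \<open>G\<close>-functor axiom is the cocycle condition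
  at \<open>(g, h, e)\<close>.

  A quasi-inverse of \<open>U\<^sub>e\<close> sends \<open>X\<close> to its orbit \<open>g \<mapsto> g\<^sub>*(X)\<close> with structure isomorphisms
  \<open>\<phi>(g, h)\<^sub>X\<inverse>\<close>; the cocycle condition is the inverted coherence axiom of \<open>\<phi>\<close> (\<open>orbit_Ob\<close>). Since
  \<open>e\<^sub>*\<close> is the identity, the orbit takes the value \<open>X\<close> at \<open>e\<close>, and in the other direction the
  arrows \<open>\<eta>\<^sub>g\<^sub>,\<^sub>e\<close> form an isomorphism from the orbit of \<open>L\<^sub>e\<close> to \<open>L\<close>
  (\<open>orbit_to_family_nat_iso\<close>).
\<close>

section \<open>Isomorphisms in categories and monoidal categories\<close>

context category
begin

text \<open>The rules below compute sources and targets by rewriting, so that the simplifier settles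
  the composability conditions of every equation between composites.\<close>

lemma Ar_Idn [simp]: "X \<in> Ob C \<Longrightarrow> Idn C X \<in> Ar C"
  and Src_Idn [simp]: "X \<in> Ob C \<Longrightarrow> Src C (Idn C X) = X"
  and Tgt_Idn [simp]: "X \<in> Ob C \<Longrightarrow> Tgt C (Idn C X) = X"
  using Idn_Hom by (auto simp: Hom_def)

lemma Ar_Cmp [simp]:
    "\<lbrakk>f \<in> Ar C; g \<in> Ar C; Tgt C f = Src C g\<rbrakk> \<Longrightarrow> g \<cdot> f \<in> Ar C"
  and Src_Cmp [simp]:
    "\<lbrakk>f \<in> Ar C; g \<in> Ar C; Tgt C f = Src C g\<rbrakk> \<Longrightarrow> Src C (g \<cdot> f) = Src C f"
  and Tgt_Cmp [simp]:
    "\<lbrakk>f \<in> Ar C; g \<in> Ar C; Tgt C f = Src C g\<rbrakk> \<Longrightarrow> Tgt C (g \<cdot> f) = Tgt C g"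
  using Cmp_Hom[of f "Src C f" "Src C g" g "Tgt C g"] by (auto simp: Hom_def)

lemma Cmp_Idn_Src [simp]: "\<lbrakk>f \<in> Ar C; Src C f = X\<rbrakk> \<Longrightarrow> f \<cdot> Idn C X = f"
  and Idn_Tgt_Cmp [simp]: "\<lbrakk>f \<in> Ar C; Tgt C f = Y\<rbrakk> \<Longrightarrow> Idn C Y \<cdot> f = f"
  using Cmp_Idn Idn_Cmp by (auto simp: Hom_def)

lemma Cmp_assoc_Ar:
  "\<lbrakk>f \<in> Ar C; g \<in> Ar C; h \<in> Ar C; Tgt C f = Src C g; Tgt C g = Src C h\<rbrakk>
    \<Longrightarrow> (h \<cdot> g) \<cdot> f = h \<cdot> (g \<cdot> f)"
  by (rule Cmp_assoc) (auto simp: Hom_def)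

lemma Src_Ob' [simp]: "f \<in> Ar C \<Longrightarrow> Src C f \<in> Ob C"
  and Tgt_Ob' [simp]: "f \<in> Ar C \<Longrightarrow> Tgt C f \<in> Ob C"
  by (auto intro: Src_Ob Tgt_Ob)

lemma IsoI:
  "\<lbrakk>f \<in> Hom C X Y; g \<in> Hom C Y X; g \<cdot> f = Idn C X; f \<cdot> g = Idn C Y\<rbrakk> \<Longrightarrow> f \<in> Iso C X Y"
  by (auto simp: Iso_def)

lemma Iso_Hom: "f \<in> Iso C X Y \<Longrightarrow> f \<in> Hom C X Y"
  by (auto simp: Iso_def)

lemma Iso_Idn: "X \<in> Ob C \<Longrightarrow> Idn C X \<in> Iso C X X"
  by (rule IsoI[where g = "Idn C X"]) (simp_all add: Hom_def)

lemma Iso_Cmp: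
  assumes f: "f \<in> Iso C X Y" and g: "g \<in> Iso C Y Z"
  shows "g \<cdot> f \<in> Iso C X Z"
proof -
  obtain f' where f': "f' \<in> Hom C Y X" "f' \<cdot> f = Idn C X" "f \<cdot> f' = Idn C Y"
    using f by (auto simp: Iso_def)
  obtain g' where g': "g' \<in> Hom C Z Y" "g' \<cdot> g = Idn C Y" "g \<cdot> g' = Idn C Z"
    using g by (auto simp: Iso_def)
  have fH: "f \<in> Hom C X Y" and gH: "g \<in> Hom C Y Z"
    using f g by (auto intro: Iso_Hom)
  have "(f' \<cdot> g') \<cdot> (g \<cdot> f) = f' \<cdot> ((g' \<cdot> g) \<cdot> f)"
    using fH gH f'(1) g'(1) by (auto simp: Hom_def Cmp_assoc_Ar)
  also have "\<dots> = Idn C X"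
    using fH f'(2) g'(2) by (auto simp: Hom_def)
  finally have 1: "(f' \<cdot> g') \<cdot> (g \<cdot> f) = Idn C X" .
  have "(g \<cdot> f) \<cdot> (f' \<cdot> g') = g \<cdot> ((f \<cdot> f') \<cdot> g')"
    using fH gH f'(1) g'(1) by (auto simp: Hom_def Cmp_assoc_Ar)
  also have "\<dots> = Idn C Z"
    using g'(1,3) f'(3) by (auto simp: Hom_def)
  finally have 2: "(g \<cdot> f) \<cdot> (f' \<cdot> g') = Idn C Z" .
  show ?thesis
    using 1 2 fH gH f'(1) g'(1) by (intro IsoI[where g = "f' \<cdot> g'"]) (auto intro: Cmp_Hom)
qed

lemma Iso_idempotent:
  assumes f: "f \<in> Iso C X X" and ff: "f \<cdot> f = f"
  shows "f = Idn C X"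
proof -
  obtain f' where f': "f' \<in> Hom C X X" "f' \<cdot> f = Idn C X"
    using f by (auto simp: Iso_def)
  have fH: "f \<in> Hom C X X"
    using f by (rule Iso_Hom)
  have "f = (f' \<cdot> f) \<cdot> f"
    using fH f'(2) by (simp add: Hom_def)
  also have "\<dots> = f' \<cdot> (f \<cdot> f)"
    using fH f'(1) by (auto simp: Hom_def Cmp_assoc_Ar)
  also have "\<dots> = Idn C X"
    using ff f'(2) by simp
  finally show ?thesis .
qed

text \<open>Stated for a right inverse of \<open>s\<close> and a left inverse of \<open>t\<close> so that it applies directly to
  composite sides, whose inverses are given as composites.\<close>

lemma square_invert:
  assumes typing: "s' \<in> Hom C X' X" "s \<in> Hom C X X'" "t \<in> Hom C Y Y'" "t' \<in> Hom C Y' Y"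
      "f \<in> Hom C X Y" "g \<in> Hom C X' Y'"
    and inv: "s \<cdot> s' = Idn C X'" "t' \<cdot> t = Idn C Y"
    and square: "t \<cdot> f = g \<cdot> s"
  shows "t' \<cdot> g = f \<cdot> s'"
proof -
  have "t' \<cdot> g = t' \<cdot> (g \<cdot> (s \<cdot> s'))"
    using typing by (simp add: Hom_def inv)
  also have "\<dots> = t' \<cdot> ((g \<cdot> s) \<cdot> s')"
    using typing by (auto simp: Hom_def Cmp_assoc_Ar)
  also have "\<dots> = (t' \<cdot> t) \<cdot> (f \<cdot> s')"
    unfolding square[symmetric] using typing by (auto simp: Hom_def Cmp_assoc_Ar)
  also have "\<dots> = f \<cdot> s'"
    using typing by (auto simp: Hom_def inv)
  finally show ?thesis .
qed

end

definition inv_ar :: "('o, 'm, 'z) cat_scheme \<Rightarrow> 'm \<Rightarrow> 'm" where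
  "inv_ar C f = (SOME g. g \<in> Hom C (Tgt C f) (Src C f) \<and>
     g \<cdot>\<^bsub>C\<^esub> f = Idn C (Src C f) \<and> f \<cdot>\<^bsub>C\<^esub> g = Idn C (Tgt C f))"

lemma inv_ar:
  assumes "f \<in> Iso C X Y"
  shows inv_ar_Hom: "inv_ar C f \<in> Hom C Y X"
    and inv_ar_Cmp: "inv_ar C f \<cdot>\<^bsub>C\<^esub> f = Idn C X"
    and Cmp_inv_ar: "f \<cdot>\<^bsub>C\<^esub> inv_ar C f = Idn C Y"
proof -
  have "\<exists>g. g \<in> Hom C (Tgt C f) (Src C f) \<and>
      g \<cdot>\<^bsub>C\<^esub> f = Idn C (Src C f) \<and> f \<cdot>\<^bsub>C\<^esub> g = Idn C (Tgt C f)"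
    using assms by (auto simp: Iso_def Hom_def)
  from someI_ex[OF this]
  have "inv_ar C f \<in> Hom C (Tgt C f) (Src C f) \<and>
      inv_ar C f \<cdot>\<^bsub>C\<^esub> f = Idn C (Src C f) \<and> f \<cdot>\<^bsub>C\<^esub> inv_ar C f = Idn C (Tgt C f)"
    unfolding inv_ar_def .
  then show "inv_ar C f \<in> Hom C Y X" "inv_ar C f \<cdot>\<^bsub>C\<^esub> f = Idn C X"
    "f \<cdot>\<^bsub>C\<^esub> inv_ar C f = Idn C Y"
    using assms by (auto simp: Iso_def Hom_def)
qed

context category
begin

lemma inv_ar_Iso: "f \<in> Iso C X Y \<Longrightarrow> inv_ar C f \<in> Iso C Y X"
  by (rule IsoI[where g = f]) (auto intro: inv_ar Iso_Hom)

lemma inv_ar_Idn [simp]: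
  assumes "X \<in> Ob C"
  shows "inv_ar C (Idn C X) = Idn C X"
proof -
  note inv = inv_ar[OF Iso_Idn[OF assms]]
  show ?thesis
    using inv(1,3) by (simp add: Hom_def)
qed

end

context cat_functor
begin

lemma Ob_map [simp]: "X \<in> Ob C \<Longrightarrow> F \<bullet>\<^sub>o X \<in> Ob D"
  by (rule ob_map_Ob)

lemma Ar_map [simp]: "f \<in> Ar C \<Longrightarrow> F \<bullet>\<^sub>a f \<in> Ar D"
  and Src_map [simp]: "f \<in> Ar C \<Longrightarrow> Src D (F \<bullet>\<^sub>a f) = F \<bullet>\<^sub>o Src C f"
  and Tgt_map [simp]: "f \<in> Ar C \<Longrightarrow> Tgt D (F \<bullet>\<^sub>a f) = F \<bullet>\<^sub>o Tgt C f"
  using ar_map_Hom[of f "Src C f" "Tgt C f"] by (auto simp: Hom_def)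

lemma map_Cmp:
  "\<lbrakk>f \<in> Ar C; g \<in> Ar C; Tgt C f = Src C g\<rbrakk> \<Longrightarrow> F \<bullet>\<^sub>a (g \<cdot>\<^bsub>C\<^esub> f) = (F \<bullet>\<^sub>a g) \<cdot>\<^bsub>D\<^esub> (F \<bullet>\<^sub>a f)"
  by (rule ar_map_Cmp) (auto simp: Hom_def)

lemma map_Iso:
  assumes "f \<in> Iso C X Y"
  shows "F \<bullet>\<^sub>a f \<in> Iso D (F \<bullet>\<^sub>o X) (F \<bullet>\<^sub>o Y)"
proof -
  obtain g where g: "g \<in> Hom C Y X" "g \<cdot>\<^bsub>C\<^esub> f = Idn C X" "f \<cdot>\<^bsub>C\<^esub> g = Idn C Y"
    using assms by (auto simp: Iso_def)
  have f: "f \<in> Hom C X Y"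
    using assms by (rule src.Iso_Hom)
  have X: "X \<in> Ob C" and Y: "Y \<in> Ob C"
    using f by (auto simp: Hom_def)
  show ?thesis
  proof (rule tgt.IsoI)
    show "(F \<bullet>\<^sub>a g) \<cdot>\<^bsub>D\<^esub> (F \<bullet>\<^sub>a f) = Idn D (F \<bullet>\<^sub>o X)"
      using ar_map_Cmp[OF f g(1)] g(2) ar_map_Idn[OF X] by simp
    show "(F \<bullet>\<^sub>a f) \<cdot>\<^bsub>D\<^esub> (F \<bullet>\<^sub>a g) = Idn D (F \<bullet>\<^sub>o Y)"
      using ar_map_Cmp[OF g(1) f] g(3) ar_map_Idn[OF Y] by simp
  qed (use f g in \<open>auto intro: ar_map_Hom\<close>)
qed

end

lemma cat_functor_comp:
  assumes "cat_functor C D F" and "cat_functor D E K"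
  shows "cat_functor C E (fctr_comp K F)"
proof -
  interpret F: cat_functor C D F by fact
  interpret K: cat_functor D E K by fact
  show ?thesis
    by unfold_locales
      (auto simp: fctr_comp_def Hom_def F.map_Cmp K.map_Cmp F.ar_map_Idn K.ar_map_Idn)
qed

context monoidal_category
begin

lemma Ob_tens [simp]: "\<lbrakk>X \<in> Ob C; Y \<in> Ob C\<rbrakk> \<Longrightarrow> X \<boxtimes>\<^sub>o Y \<in> Ob C"
  by (rule tens_ob_Ob)

lemma Ar_tens [simp]: "\<lbrakk>f \<in> Ar C; g \<in> Ar C\<rbrakk> \<Longrightarrow> f \<boxtimes>\<^sub>a g \<in> Ar C"
  and Src_tens [simp]: "\<lbrakk>f \<in> Ar C; g \<in> Ar C\<rbrakk> \<Longrightarrow> Src C (f \<boxtimes>\<^sub>a g) = Src C f \<boxtimes>\<^sub>o Src C g"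
  and Tgt_tens [simp]: "\<lbrakk>f \<in> Ar C; g \<in> Ar C\<rbrakk> \<Longrightarrow> Tgt C (f \<boxtimes>\<^sub>a g) = Tgt C f \<boxtimes>\<^sub>o Tgt C g"
  using tens_ar_Hom[of f "Src C f" "Tgt C f" g "Src C g" "Tgt C g"] by (auto simp: Hom_def)

declare unit_ob_Ob [simp] unit_tens_ob [simp] tens_unit_ob [simp]
  unit_tens_ar [simp] tens_unit_ar [simp] tens_ar_Idn [simp]

lemma tens_Cmp:
  "\<lbrakk>f \<in> Ar C; f' \<in> Ar C; g \<in> Ar C; g' \<in> Ar C; Tgt C f = Src C f'; Tgt C g = Src C g'\<rbrakk>
    \<Longrightarrow> (f' \<boxtimes>\<^sub>a g') \<cdot> (f \<boxtimes>\<^sub>a g) = (f' \<cdot> f) \<boxtimes>\<^sub>a (g' \<cdot> g)"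
  by (rule tens_ar_Cmp[symmetric]) (auto simp: Hom_def)

lemma Cmp_tens_Idn:
  "\<lbrakk>f \<in> Ar C; f' \<in> Ar C; Tgt C f = Src C f'; Z \<in> Ob C\<rbrakk>
    \<Longrightarrow> (f' \<boxtimes>\<^sub>a Idn C Z) \<cdot> (f \<boxtimes>\<^sub>a Idn C Z) = (f' \<cdot> f) \<boxtimes>\<^sub>a Idn C Z"
  by (simp add: tens_Cmp)

lemma Idn_tens_Cmp:
  "\<lbrakk>f \<in> Ar C; f' \<in> Ar C; Tgt C f = Src C f'; Z \<in> Ob C\<rbrakk>
    \<Longrightarrow> (Idn C Z \<boxtimes>\<^sub>a f') \<cdot> (Idn C Z \<boxtimes>\<^sub>a f) = Idn C Z \<boxtimes>\<^sub>a (f' \<cdot> f)"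
  by (simp add: tens_Cmp)

lemma tens_Iso:
  assumes f: "f \<in> Iso C X X'" and g: "g \<in> Iso C Y Y'"
  shows "f \<boxtimes>\<^sub>a g \<in> Iso C (X \<boxtimes>\<^sub>o Y) (X' \<boxtimes>\<^sub>o Y')"
proof (rule IsoI)
  note f' = inv_ar[OF f] and g' = inv_ar[OF g]
  note homs = Iso_Hom[OF f] Iso_Hom[OF g] f'(1) g'(1)
  then have obs: "X \<in> Ob C" "X' \<in> Ob C" "Y \<in> Ob C" "Y' \<in> Ob C"
    by (auto simp: Hom_def)
  show "f \<boxtimes>\<^sub>a g \<in> Hom C (X \<boxtimes>\<^sub>o Y) (X' \<boxtimes>\<^sub>o Y')"
    "inv_ar C f \<boxtimes>\<^sub>a inv_ar C g \<in> Hom C (X' \<boxtimes>\<^sub>o Y') (X \<boxtimes>\<^sub>o Y)"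
    using homs by (auto intro: tens_ar_Hom)
  show "(inv_ar C f \<boxtimes>\<^sub>a inv_ar C g) \<cdot> (f \<boxtimes>\<^sub>a g) = Idn C (X \<boxtimes>\<^sub>o Y)"
    using homs obs f'(2) g'(2) by (auto simp: Hom_def tens_Cmp)
  show "(f \<boxtimes>\<^sub>a g) \<cdot> (inv_ar C f \<boxtimes>\<^sub>a inv_ar C g) = Idn C (X' \<boxtimes>\<^sub>o Y')"
    using homs obs f'(3) g'(3) by (auto simp: Hom_def tens_Cmp)
qed

text \<open>The interchange law applied to \<open>(f \<otimes> id)(id \<otimes> f)\<close>: one half of the Eckmann-Hilton argument.\<close>

lemma tens_unit_endo:
  assumes "f \<in> Hom C (unit_ob C) (unit_ob C)"
  shows "f \<boxtimes>\<^sub>a f = f \<cdot> f"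
proof -
  have "(f \<boxtimes>\<^sub>a Idn C (unit_ob C)) \<cdot> (Idn C (unit_ob C) \<boxtimes>\<^sub>a f) = f \<boxtimes>\<^sub>a f"
    using assms by (subst tens_Cmp) (auto simp: Hom_def)
  then show ?thesis
    using assms by (simp add: Hom_def)
qed

end

context monoidal_functor
begin

lemma fctr2_Iso: "\<lbrakk>X \<in> Ob C; Y \<in> Ob C\<rbrakk>
    \<Longrightarrow> fctr2 F X Y \<in> Iso D (F \<bullet>\<^sub>o (X \<boxtimes>\<^sub>o\<^bsub>C\<^esub> Y)) ((F \<bullet>\<^sub>o X) \<boxtimes>\<^sub>o\<^bsub>D\<^esub> (F \<bullet>\<^sub>o Y))"
  using fctr2_nat_iso by (simp add: tens_nat_iso_def)

lemma fctr2_Ar [simp]: "\<lbrakk>X \<in> Ob C; Y \<in> Ob C\<rbrakk> \<Longrightarrow> fctr2 F X Y \<in> Ar D"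
  and fctr2_Src [simp]: "\<lbrakk>X \<in> Ob C; Y \<in> Ob C\<rbrakk> \<Longrightarrow> Src D (fctr2 F X Y) = F \<bullet>\<^sub>o (X \<boxtimes>\<^sub>o\<^bsub>C\<^esub> Y)"
  and fctr2_Tgt [simp]: "\<lbrakk>X \<in> Ob C; Y \<in> Ob C\<rbrakk>
    \<Longrightarrow> Tgt D (fctr2 F X Y) = (F \<bullet>\<^sub>o X) \<boxtimes>\<^sub>o\<^bsub>D\<^esub> (F \<bullet>\<^sub>o Y)"
  using fctr2_Iso[of X Y] by (auto simp: Iso_def Hom_def)

lemma fctr0_Ar [simp]: "fctr0 F \<in> Ar D"
  and fctr0_Src [simp]: "Src D (fctr0 F) = F \<bullet>\<^sub>o unit_ob C"
  and fctr0_Tgt [simp]: "Tgt D (fctr0 F) = unit_ob D"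
  using fctr0_Iso by (auto simp: Iso_def Hom_def)

lemma fctr2_natural:
  "\<lbrakk>f \<in> Ar C; f' \<in> Ar C\<rbrakk>
    \<Longrightarrow> fctr2 F (Tgt C f) (Tgt C f') \<cdot>\<^bsub>D\<^esub> (F \<bullet>\<^sub>a (f \<boxtimes>\<^sub>a\<^bsub>C\<^esub> f'))
      = ((F \<bullet>\<^sub>a f) \<boxtimes>\<^sub>a\<^bsub>D\<^esub> (F \<bullet>\<^sub>a f')) \<cdot>\<^bsub>D\<^esub> fctr2 F (Src C f) (Src C f')"
  using fctr2_nat_iso unfolding tens_nat_iso_def by (auto simp: Hom_def)

end

text \<open>In each coherence law for the composite, naturality of the second functor's structure
  isomorphism moves the first functor's one past it. The composite then splits into the coherence
  law of the second functor and the image of that of the first.\<close>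

lemma monoidal_functor_comp:
  assumes "monoidal_functor C D F" and "monoidal_functor D E K"
  shows "monoidal_functor C E (mon_fctr_comp E K F)"
proof -
  interpret F: monoidal_functor C D F by fact
  interpret K: monoidal_functor D E K by fact
  let ?KF = "mon_fctr_comp E K F"
  have sel [simp]: "?KF \<bullet>\<^sub>o X = K \<bullet>\<^sub>o F \<bullet>\<^sub>o X" "?KF \<bullet>\<^sub>a f = K \<bullet>\<^sub>a F \<bullet>\<^sub>a f"
    "fctr2 ?KF X Y = fctr2 K (F \<bullet>\<^sub>o X) (F \<bullet>\<^sub>o Y) \<cdot>\<^bsub>E\<^esub> (K \<bullet>\<^sub>a fctr2 F X Y)"
    "fctr0 ?KF = fctr0 K \<cdot>\<^bsub>E\<^esub> (K \<bullet>\<^sub>a fctr0 F)" for X Y f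
    by (simp_all add: mon_fctr_comp_def)
  show ?thesis
  proof unfold_locales
    fix X assume "X \<in> Ob C" then show "?KF \<bullet>\<^sub>o X \<in> Ob E" by simp
  next
    fix f X Y assume "f \<in> Hom C X Y"
    then show "?KF \<bullet>\<^sub>a f \<in> Hom E (?KF \<bullet>\<^sub>o X) (?KF \<bullet>\<^sub>o Y)" by (auto simp: Hom_def)
  next
    fix X assume "X \<in> Ob C"
    then show "?KF \<bullet>\<^sub>a Idn C X = Idn E (?KF \<bullet>\<^sub>o X)" by (simp add: F.ar_map_Idn K.ar_map_Idn)
  next
    fix f g X Y Z assume "f \<in> Hom C X Y" "g \<in> Hom C Y Z"
    then show "?KF \<bullet>\<^sub>a (g \<cdot>\<^bsub>C\<^esub> f) = (?KF \<bullet>\<^sub>a g) \<cdot>\<^bsub>E\<^esub> (?KF \<bullet>\<^sub>a f)"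
      by (auto simp: Hom_def F.map_Cmp K.map_Cmp)
  next
    show "tens_nat_iso C E ?KF (fctr2 ?KF)"
      unfolding tens_nat_iso_def
    proof (intro conjI ballI allI)
      fix X Y assume "X \<in> Ob C" "Y \<in> Ob C"
      then show "fctr2 ?KF X Y \<in> Iso E (?KF \<bullet>\<^sub>o (X \<boxtimes>\<^sub>o\<^bsub>C\<^esub> Y)) ((?KF \<bullet>\<^sub>o X) \<boxtimes>\<^sub>o\<^bsub>E\<^esub> (?KF \<bullet>\<^sub>o Y))"
        by (auto intro!: K.tgt.Iso_Cmp[OF K.map_Iso[OF F.fctr2_Iso] K.fctr2_Iso])
    next
      fix X X' Y Y' f g assume f: "f \<in> Hom C X X'" and g: "g \<in> Hom C Y Y'"
      then have typing: "f \<in> Ar C" "g \<in> Ar C" "X \<in> Ob C" "X' \<in> Ob C" "Y \<in> Ob C" "Y' \<in> Ob C"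
        "Src C f = X" "Tgt C f = X'" "Src C g = Y" "Tgt C g = Y'"
        by (auto simp: Hom_def)
      have "fctr2 ?KF X' Y' \<cdot>\<^bsub>E\<^esub> (?KF \<bullet>\<^sub>a (f \<boxtimes>\<^sub>a\<^bsub>C\<^esub> g))
          = fctr2 K (F \<bullet>\<^sub>o X') (F \<bullet>\<^sub>o Y') \<cdot>\<^bsub>E\<^esub> (K \<bullet>\<^sub>a (fctr2 F X' Y' \<cdot>\<^bsub>D\<^esub> (F \<bullet>\<^sub>a (f \<boxtimes>\<^sub>a\<^bsub>C\<^esub> g))))"
        using typing by (simp add: K.map_Cmp K.tgt.Cmp_assoc_Ar)
      also have "\<dots> = (fctr2 K (F \<bullet>\<^sub>o X') (F \<bullet>\<^sub>o Y') \<cdot>\<^bsub>E\<^esub> (K \<bullet>\<^sub>a ((F \<bullet>\<^sub>a f) \<boxtimes>\<^sub>a\<^bsub>D\<^esub> (F \<bullet>\<^sub>a g))))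
          \<cdot>\<^bsub>E\<^esub> (K \<bullet>\<^sub>a fctr2 F X Y)"
        using typing F.fctr2_natural[of f g] by (simp add: K.map_Cmp K.tgt.Cmp_assoc_Ar)
      also have "\<dots> = ((?KF \<bullet>\<^sub>a f) \<boxtimes>\<^sub>a\<^bsub>E\<^esub> (?KF \<bullet>\<^sub>a g)) \<cdot>\<^bsub>E\<^esub> fctr2 ?KF X Y"
        using typing K.fctr2_natural[of "F \<bullet>\<^sub>a f" "F \<bullet>\<^sub>a g"] by (simp add: K.tgt.Cmp_assoc_Ar)
      finally show "fctr2 ?KF X' Y' \<cdot>\<^bsub>E\<^esub> (?KF \<bullet>\<^sub>a (f \<boxtimes>\<^sub>a\<^bsub>C\<^esub> g))
          = ((?KF \<bullet>\<^sub>a f) \<boxtimes>\<^sub>a\<^bsub>E\<^esub> (?KF \<bullet>\<^sub>a g)) \<cdot>\<^bsub>E\<^esub> fctr2 ?KF X Y" .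
    qed
  next
    show "fctr0 ?KF \<in> Iso E (?KF \<bullet>\<^sub>o unit_ob C) (unit_ob E)"
      by (auto intro!: K.tgt.Iso_Cmp[OF K.map_Iso[OF F.fctr0_Iso] K.fctr0_Iso])
  next
    fix X Y Z assume Ob: "X \<in> Ob C" "Y \<in> Ob C" "Z \<in> Ob C"
    let ?FX = "F \<bullet>\<^sub>o X" and ?FY = "F \<bullet>\<^sub>o Y" and ?FZ = "F \<bullet>\<^sub>o Z"
    have "(fctr2 ?KF X Y \<boxtimes>\<^sub>a\<^bsub>E\<^esub> Idn E (?KF \<bullet>\<^sub>o Z)) \<cdot>\<^bsub>E\<^esub> fctr2 ?KF (X \<boxtimes>\<^sub>o\<^bsub>C\<^esub> Y) Z
        = (fctr2 K ?FX ?FY \<boxtimes>\<^sub>a\<^bsub>E\<^esub> Idn E (K \<bullet>\<^sub>o ?FZ)) \<cdot>\<^bsub>E\<^esub>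
          (((K \<bullet>\<^sub>a fctr2 F X Y) \<boxtimes>\<^sub>a\<^bsub>E\<^esub> (K \<bullet>\<^sub>a Idn D ?FZ)) \<cdot>\<^bsub>E\<^esub> fctr2 K (F \<bullet>\<^sub>o (X \<boxtimes>\<^sub>o\<^bsub>C\<^esub> Y)) ?FZ)
          \<cdot>\<^bsub>E\<^esub> (K \<bullet>\<^sub>a fctr2 F (X \<boxtimes>\<^sub>o\<^bsub>C\<^esub> Y) Z)"
      using Ob by (simp add: K.ar_map_Idn K.tgt.Cmp_assoc_Ar flip: K.tgt.Cmp_tens_Idn)
    also have "\<dots> = ((fctr2 K ?FX ?FY \<boxtimes>\<^sub>a\<^bsub>E\<^esub> Idn E (K \<bullet>\<^sub>o ?FZ)) \<cdot>\<^bsub>E\<^esub> fctr2 K (?FX \<boxtimes>\<^sub>o\<^bsub>D\<^esub> ?FY) ?FZ) \<cdot>\<^bsub>E\<^esub>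
          (K \<bullet>\<^sub>a ((fctr2 F X Y \<boxtimes>\<^sub>a\<^bsub>D\<^esub> Idn D ?FZ) \<cdot>\<^bsub>D\<^esub> fctr2 F (X \<boxtimes>\<^sub>o\<^bsub>C\<^esub> Y) Z))"
      using Ob K.fctr2_natural[of "fctr2 F X Y" "Idn D ?FZ", symmetric]
      by (simp add: K.map_Cmp K.tgt.Cmp_assoc_Ar K.tgt.tens_ob_assoc)
    also have "\<dots> = ((Idn E (K \<bullet>\<^sub>o ?FX) \<boxtimes>\<^sub>a\<^bsub>E\<^esub> fctr2 K ?FY ?FZ) \<cdot>\<^bsub>E\<^esub> fctr2 K ?FX (?FY \<boxtimes>\<^sub>o\<^bsub>D\<^esub> ?FZ)) \<cdot>\<^bsub>E\<^esub>
          (K \<bullet>\<^sub>a ((Idn D ?FX \<boxtimes>\<^sub>a\<^bsub>D\<^esub> fctr2 F Y Z) \<cdot>\<^bsub>D\<^esub> fctr2 F X (Y \<boxtimes>\<^sub>o\<^bsub>C\<^esub> Z)))"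
      using Ob by (simp add: F.fctr2_assoc K.fctr2_assoc)
    also have "\<dots> = (Idn E (K \<bullet>\<^sub>o ?FX) \<boxtimes>\<^sub>a\<^bsub>E\<^esub> fctr2 K ?FY ?FZ) \<cdot>\<^bsub>E\<^esub>
          (((K \<bullet>\<^sub>a Idn D ?FX) \<boxtimes>\<^sub>a\<^bsub>E\<^esub> (K \<bullet>\<^sub>a fctr2 F Y Z)) \<cdot>\<^bsub>E\<^esub> fctr2 K ?FX (F \<bullet>\<^sub>o (Y \<boxtimes>\<^sub>o\<^bsub>C\<^esub> Z)))
          \<cdot>\<^bsub>E\<^esub> (K \<bullet>\<^sub>a fctr2 F X (Y \<boxtimes>\<^sub>o\<^bsub>C\<^esub> Z))"
      using Ob K.fctr2_natural[of "Idn D ?FX" "fctr2 F Y Z", symmetric]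
      by (simp add: K.map_Cmp K.tgt.Cmp_assoc_Ar K.tgt.tens_ob_assoc)
    also have "\<dots> = (Idn E (?KF \<bullet>\<^sub>o X) \<boxtimes>\<^sub>a\<^bsub>E\<^esub> fctr2 ?KF Y Z) \<cdot>\<^bsub>E\<^esub> fctr2 ?KF X (Y \<boxtimes>\<^sub>o\<^bsub>C\<^esub> Z)"
      using Ob by (simp add: K.ar_map_Idn K.tgt.Cmp_assoc_Ar flip: K.tgt.Idn_tens_Cmp)
    finally show "(fctr2 ?KF X Y \<boxtimes>\<^sub>a\<^bsub>E\<^esub> Idn E (?KF \<bullet>\<^sub>o Z)) \<cdot>\<^bsub>E\<^esub> fctr2 ?KF (X \<boxtimes>\<^sub>o\<^bsub>C\<^esub> Y) Z
        = (Idn E (?KF \<bullet>\<^sub>o X) \<boxtimes>\<^sub>a\<^bsub>E\<^esub> fctr2 ?KF Y Z) \<cdot>\<^bsub>E\<^esub> fctr2 ?KF X (Y \<boxtimes>\<^sub>o\<^bsub>C\<^esub> Z)" .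
  next
    fix X assume Ob: "X \<in> Ob C"
    let ?FX = "F \<bullet>\<^sub>o X" and ?F1 = "F \<bullet>\<^sub>o unit_ob C"
    have "(Idn E (?KF \<bullet>\<^sub>o X) \<boxtimes>\<^sub>a\<^bsub>E\<^esub> fctr0 ?KF) \<cdot>\<^bsub>E\<^esub> fctr2 ?KF X (unit_ob C)
        = (Idn E (K \<bullet>\<^sub>o ?FX) \<boxtimes>\<^sub>a\<^bsub>E\<^esub> fctr0 K) \<cdot>\<^bsub>E\<^esub>
          (((K \<bullet>\<^sub>a Idn D ?FX) \<boxtimes>\<^sub>a\<^bsub>E\<^esub> (K \<bullet>\<^sub>a fctr0 F)) \<cdot>\<^bsub>E\<^esub> fctr2 K ?FX ?F1)
          \<cdot>\<^bsub>E\<^esub> (K \<bullet>\<^sub>a fctr2 F X (unit_ob C))"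
      using Ob by (simp add: K.ar_map_Idn K.tgt.Cmp_assoc_Ar flip: K.tgt.Idn_tens_Cmp)
    also have "\<dots> = ((Idn E (K \<bullet>\<^sub>o ?FX) \<boxtimes>\<^sub>a\<^bsub>E\<^esub> fctr0 K) \<cdot>\<^bsub>E\<^esub> fctr2 K ?FX (unit_ob D)) \<cdot>\<^bsub>E\<^esub>
          (K \<bullet>\<^sub>a ((Idn D ?FX \<boxtimes>\<^sub>a\<^bsub>D\<^esub> fctr0 F) \<cdot>\<^bsub>D\<^esub> fctr2 F X (unit_ob C)))"
      using Ob K.fctr2_natural[of "Idn D ?FX" "fctr0 F", symmetric]
      by (simp add: K.map_Cmp K.tgt.Cmp_assoc_Ar)
    also have "\<dots> = Idn E (?KF \<bullet>\<^sub>o X)"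
      using Ob by (simp add: F.fctr2_unit_right K.fctr2_unit_right K.ar_map_Idn)
    finally show "(Idn E (?KF \<bullet>\<^sub>o X) \<boxtimes>\<^sub>a\<^bsub>E\<^esub> fctr0 ?KF) \<cdot>\<^bsub>E\<^esub> fctr2 ?KF X (unit_ob C) = Idn E (?KF \<bullet>\<^sub>o X)" .
    have "(fctr0 ?KF \<boxtimes>\<^sub>a\<^bsub>E\<^esub> Idn E (?KF \<bullet>\<^sub>o X)) \<cdot>\<^bsub>E\<^esub> fctr2 ?KF (unit_ob C) X
        = (fctr0 K \<boxtimes>\<^sub>a\<^bsub>E\<^esub> Idn E (K \<bullet>\<^sub>o ?FX)) \<cdot>\<^bsub>E\<^esub>
          (((K \<bullet>\<^sub>a fctr0 F) \<boxtimes>\<^sub>a\<^bsub>E\<^esub> (K \<bullet>\<^sub>a Idn D ?FX)) \<cdot>\<^bsub>E\<^esub> fctr2 K ?F1 ?FX)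
          \<cdot>\<^bsub>E\<^esub> (K \<bullet>\<^sub>a fctr2 F (unit_ob C) X)"
      using Ob by (simp add: K.ar_map_Idn K.tgt.Cmp_assoc_Ar flip: K.tgt.Cmp_tens_Idn)
    also have "\<dots> = ((fctr0 K \<boxtimes>\<^sub>a\<^bsub>E\<^esub> Idn E (K \<bullet>\<^sub>o ?FX)) \<cdot>\<^bsub>E\<^esub> fctr2 K (unit_ob D) ?FX) \<cdot>\<^bsub>E\<^esub>
          (K \<bullet>\<^sub>a ((fctr0 F \<boxtimes>\<^sub>a\<^bsub>D\<^esub> Idn D ?FX) \<cdot>\<^bsub>D\<^esub> fctr2 F (unit_ob C) X))"
      using Ob K.fctr2_natural[of "fctr0 F" "Idn D ?FX", symmetric]
      by (simp add: K.map_Cmp K.tgt.Cmp_assoc_Ar)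
    also have "\<dots> = Idn E (?KF \<bullet>\<^sub>o X)"
      using Ob by (simp add: F.fctr2_unit_left K.fctr2_unit_left K.ar_map_Idn)
    finally show "(fctr0 ?KF \<boxtimes>\<^sub>a\<^bsub>E\<^esub> Idn E (?KF \<bullet>\<^sub>o X)) \<cdot>\<^bsub>E\<^esub> fctr2 ?KF (unit_ob C) X = Idn E (?KF \<bullet>\<^sub>o X)" .
  qed
qed

section \<open>Coherence in monoidal \<open>G\<close>-categories\<close>

context monoidal_G_category
begin

lemma act_Ob [simp]: "\<lbrakk>g \<in> carrier G; X \<in> Ob C\<rbrakk> \<Longrightarrow> act C g \<bullet>\<^sub>o X \<in> Ob C"
  and act_Ar [simp]: "\<lbrakk>g \<in> carrier G; f \<in> Ar C\<rbrakk> \<Longrightarrow> act C g \<bullet>\<^sub>a f \<in> Ar C"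
  and act_Src [simp]: "\<lbrakk>g \<in> carrier G; f \<in> Ar C\<rbrakk> \<Longrightarrow> Src C (act C g \<bullet>\<^sub>a f) = act C g \<bullet>\<^sub>o Src C f"
  and act_Tgt [simp]: "\<lbrakk>g \<in> carrier G; f \<in> Ar C\<rbrakk> \<Longrightarrow> Tgt C (act C g \<bullet>\<^sub>a f) = act C g \<bullet>\<^sub>o Tgt C f"
  and act_Idn [simp]: "\<lbrakk>g \<in> carrier G; X \<in> Ob C\<rbrakk> \<Longrightarrow> act C g \<bullet>\<^sub>a Idn C X = Idn C (act C g \<bullet>\<^sub>o X)"
  and act_Cmp: "\<lbrakk>g \<in> carrier G; f \<in> Ar C; f' \<in> Ar C; Tgt C f = Src C f'\<rbrakk>
    \<Longrightarrow> act C g \<bullet>\<^sub>a (f' \<cdot>\<^bsub>C\<^esub> f) = (act C g \<bullet>\<^sub>a f') \<cdot>\<^bsub>C\<^esub> (act C g \<bullet>\<^sub>a f)"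
proof -
  assume "g \<in> carrier G"
  then interpret g: cat_functor C C "act C g"
    by (rule act_functor)
  show "X \<in> Ob C \<Longrightarrow> act C g \<bullet>\<^sub>o X \<in> Ob C"
    "f \<in> Ar C \<Longrightarrow> act C g \<bullet>\<^sub>a f \<in> Ar C"
    "f \<in> Ar C \<Longrightarrow> Src C (act C g \<bullet>\<^sub>a f) = act C g \<bullet>\<^sub>o Src C f"
    "f \<in> Ar C \<Longrightarrow> Tgt C (act C g \<bullet>\<^sub>a f) = act C g \<bullet>\<^sub>o Tgt C f"
    "X \<in> Ob C \<Longrightarrow> act C g \<bullet>\<^sub>a Idn C X = Idn C (act C g \<bullet>\<^sub>o X)"
    "\<lbrakk>f \<in> Ar C; f' \<in> Ar C; Tgt C f = Src C f'\<rbrakk>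
      \<Longrightarrow> act C g \<bullet>\<^sub>a (f' \<cdot>\<^bsub>C\<^esub> f) = (act C g \<bullet>\<^sub>a f') \<cdot>\<^bsub>C\<^esub> (act C g \<bullet>\<^sub>a f)"
    by (simp_all add: g.ar_map_Idn g.map_Cmp)
qed

lemma phi_Iso: "\<lbrakk>g \<in> carrier G; h \<in> carrier G; X \<in> Ob C\<rbrakk>
    \<Longrightarrow> phi C g h X \<in> Iso C (act C (g \<otimes>\<^bsub>G\<^esub> h) \<bullet>\<^sub>o X) (act C g \<bullet>\<^sub>o act C h \<bullet>\<^sub>o X)"
  using nat_iso.component_Iso[OF phi_nat_iso] by (fastforce simp: fctr_comp_def)

lemma phi_Ar [simp]: "\<lbrakk>g \<in> carrier G; h \<in> carrier G; X \<in> Ob C\<rbrakk> \<Longrightarrow> phi C g h X \<in> Ar C"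
  and phi_Src [simp]: "\<lbrakk>g \<in> carrier G; h \<in> carrier G; X \<in> Ob C\<rbrakk>
    \<Longrightarrow> Src C (phi C g h X) = act C (g \<otimes>\<^bsub>G\<^esub> h) \<bullet>\<^sub>o X"
  and phi_Tgt [simp]: "\<lbrakk>g \<in> carrier G; h \<in> carrier G; X \<in> Ob C\<rbrakk>
    \<Longrightarrow> Tgt C (phi C g h X) = act C g \<bullet>\<^sub>o act C h \<bullet>\<^sub>o X"
  using phi_Iso[of g h X] by (auto simp: Iso_def Hom_def)

lemma phi_natural:
  "\<lbrakk>g \<in> carrier G; h \<in> carrier G; f \<in> Hom C X Y\<rbrakk>
    \<Longrightarrow> phi C g h Y \<cdot>\<^bsub>C\<^esub> (act C (g \<otimes>\<^bsub>G\<^esub> h) \<bullet>\<^sub>a f)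
      = (act C g \<bullet>\<^sub>a act C h \<bullet>\<^sub>a f) \<cdot>\<^bsub>C\<^esub> phi C g h X"
  using nat_trans.naturality[OF nat_iso.axioms(1)[OF phi_nat_iso]]
  by (fastforce simp: fctr_comp_def)

lemma psi_Iso: "\<lbrakk>g \<in> carrier G; X \<in> Ob C; Y \<in> Ob C\<rbrakk>
    \<Longrightarrow> psi C g X Y \<in> Iso C (act C g \<bullet>\<^sub>o (X \<boxtimes>\<^sub>o\<^bsub>C\<^esub> Y)) ((act C g \<bullet>\<^sub>o X) \<boxtimes>\<^sub>o\<^bsub>C\<^esub> (act C g \<bullet>\<^sub>o Y))"
  using psi_nat_iso by (auto simp: tens_nat_iso_def)

lemma psi_Ar [simp]: "\<lbrakk>g \<in> carrier G; X \<in> Ob C; Y \<in> Ob C\<rbrakk> \<Longrightarrow> psi C g X Y \<in> Ar C"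
  and psi_Src [simp]: "\<lbrakk>g \<in> carrier G; X \<in> Ob C; Y \<in> Ob C\<rbrakk>
    \<Longrightarrow> Src C (psi C g X Y) = act C g \<bullet>\<^sub>o (X \<boxtimes>\<^sub>o\<^bsub>C\<^esub> Y)"
  and psi_Tgt [simp]: "\<lbrakk>g \<in> carrier G; X \<in> Ob C; Y \<in> Ob C\<rbrakk>
    \<Longrightarrow> Tgt C (psi C g X Y) = (act C g \<bullet>\<^sub>o X) \<boxtimes>\<^sub>o\<^bsub>C\<^esub> (act C g \<bullet>\<^sub>o Y)"
  using psi_Iso[of g X Y] by (auto simp: Iso_def Hom_def)

lemma psi_natural:
  "\<lbrakk>g \<in> carrier G; f \<in> Ar C; f' \<in> Ar C\<rbrakk>
    \<Longrightarrow> psi C g (Tgt C f) (Tgt C f') \<cdot>\<^bsub>C\<^esub> (act C g \<bullet>\<^sub>a (f \<boxtimes>\<^sub>a\<^bsub>C\<^esub> f'))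
      = ((act C g \<bullet>\<^sub>a f) \<boxtimes>\<^sub>a\<^bsub>C\<^esub> (act C g \<bullet>\<^sub>a f')) \<cdot>\<^bsub>C\<^esub> psi C g (Src C f) (Src C f')"
  using psi_nat_iso[of g] unfolding tens_nat_iso_def by (auto simp: Hom_def)

declare act_unit [simp] act_one_ob [simp] act_one_ar [simp]
  psi_unit_right [simp] psi_unit_left [simp] phi_one_left [simp] phi_one_right [simp]

text \<open>At \<open>g = h = e\<close> the axiom relating \<open>\<phi>\<close> and \<open>\<psi>\<close> reads \<open>\<psi>\<^sup>e = \<psi>\<^sup>e \<psi>\<^sup>e\<close>.\<close>

lemma psi_one [simp]:
  assumes "X \<in> Ob C" "Y \<in> Ob C"
  shows "psi C \<one>\<^bsub>G\<^esub> X Y = Idn C (X \<boxtimes>\<^sub>o\<^bsub>C\<^esub> Y)"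
proof (rule Iso_idempotent)
  show "psi C \<one>\<^bsub>G\<^esub> X Y \<in> Iso C (X \<boxtimes>\<^sub>o\<^bsub>C\<^esub> Y) (X \<boxtimes>\<^sub>o\<^bsub>C\<^esub> Y)"
    using psi_Iso[of "\<one>\<^bsub>G\<^esub>" X Y] assms by simp
  show "psi C \<one>\<^bsub>G\<^esub> X Y \<cdot>\<^bsub>C\<^esub> psi C \<one>\<^bsub>G\<^esub> X Y = psi C \<one>\<^bsub>G\<^esub> X Y"
    using phi_psi[of "\<one>\<^bsub>G\<^esub>" "\<one>\<^bsub>G\<^esub>" X Y] assms by simp
qed

text \<open>At \<open>X = Y = \<one>\<close> the same axiom reads \<open>\<phi> \<otimes> \<phi> = \<phi>\<close> for \<open>\<phi> = \<phi>(g, h)\<^sub>\<one>\<close>, and on endomorphisms of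
  the unit object the tensor square is the composition square.\<close>

lemma phi_unit [simp]:
  assumes "g \<in> carrier G" "h \<in> carrier G"
  shows "phi C g h (unit_ob C) = Idn C (unit_ob C)"
proof (rule Iso_idempotent)
  show phi: "phi C g h (unit_ob C) \<in> Iso C (unit_ob C) (unit_ob C)"
    using phi_Iso[of g h "unit_ob C"] assms by simp
  show "phi C g h (unit_ob C) \<cdot>\<^bsub>C\<^esub> phi C g h (unit_ob C) = phi C g h (unit_ob C)"
    using phi_psi[of g h "unit_ob C" "unit_ob C"] assms tens_unit_endo[OF Iso_Hom[OF phi]]
    by simp
qed

end

section \<open>The strict monoidal \<open>G\<close>-category of families\<close>

lemma CG_sel [simp]:
  "Ob (CG G C) = CG_Ob G C" "Ar (CG G C) = CG_Ar G C"
  "Src (CG G C) f = fst f" "Tgt (CG G C) f = fst (snd f)"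
  "Idn (CG G C) = CG_Idn G C" "Cmp (CG G C) = CG_Cmp G C"
  "tens_ob (CG G C) = CG_tens_ob G C" "tens_ar (CG G C) = CG_tens_ar G C"
  "unit_ob (CG G C) = CG_unit G C"
  "act (CG G C) g \<bullet>\<^sub>o X = CG_act_ob G g X" "act (CG G C) g \<bullet>\<^sub>a f = CG_act_ar G g f"
  "phi (CG G C) g h X = CG_Idn G C (CG_act_ob G (g \<otimes>\<^bsub>G\<^esub> h) X)"
  "psi (CG G C) g X Y = CG_Idn G C (CG_act_ob G g (CG_tens_ob G C X Y))"
  by (simp_all add: CG_def split_beta)

lemma U_e_sel [simp]:
  "U_e G C \<bullet>\<^sub>o X = fst X \<one>\<^bsub>G\<^esub>" "U_e G C \<bullet>\<^sub>a f = snd (snd f) \<one>\<^bsub>G\<^esub>"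
  "fctr2 (U_e G C) X Y = Idn C (fst X \<one>\<^bsub>G\<^esub> \<boxtimes>\<^sub>o\<^bsub>C\<^esub> fst Y \<one>\<^bsub>G\<^esub>)"
  "fctr0 (U_e G C) = Idn C (unit_ob C)"
  by (simp_all add: U_e_def split_beta)

lemma gamma_eq [simp]: "gamma G g X = snd X (g, \<one>\<^bsub>G\<^esub>)"
  by (simp add: gamma_def split_beta)

lemma CG_ops [simp]:
  "fst (CG_Idn G C X) = X" "fst (snd (CG_Idn G C X)) = X"
  "fst (CG_Cmp G C f' f) = fst f" "fst (snd (CG_Cmp G C f' f)) = fst (snd f')"
  "fst (CG_tens_ar G C f f') = CG_tens_ob G C (fst f) (fst f')"
  "fst (snd (CG_tens_ar G C f f')) = CG_tens_ob G C (fst (snd f)) (fst (snd f'))"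
  "fst (CG_act_ar G g f) = CG_act_ob G g (fst f)"
  "fst (snd (CG_act_ar G g f)) = CG_act_ob G g (fst (snd f))"
  by (simp_all add: CG_Idn_def CG_Cmp_def CG_tens_ar_def CG_act_ar_def split_beta)

lemma CG_families [simp]:
  "x \<in> carrier G \<Longrightarrow> snd (snd (CG_Idn G C X)) x = Idn C (fst X x)"
  "x \<in> carrier G \<Longrightarrow> snd (snd (CG_Cmp G C f' f)) x = snd (snd f') x \<cdot>\<^bsub>C\<^esub> snd (snd f) x"
  "x \<in> carrier G \<Longrightarrow>
    snd (snd (CG_tens_ar G C f f')) x = snd (snd f) x \<boxtimes>\<^sub>a\<^bsub>C\<^esub> snd (snd f') x"
  "x \<in> carrier G \<Longrightarrow> snd (snd (CG_act_ar G g f)) x = snd (snd f) (x \<otimes>\<^bsub>G\<^esub> g)"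
  "x \<in> carrier G \<Longrightarrow> fst (CG_tens_ob G C X Y) x = fst X x \<boxtimes>\<^sub>o\<^bsub>C\<^esub> fst Y x"
  "\<lbrakk>x \<in> carrier G; y \<in> carrier G\<rbrakk> \<Longrightarrow> snd (CG_tens_ob G C X Y) (x, y) =
    (snd X (x, y) \<boxtimes>\<^sub>a\<^bsub>C\<^esub> snd Y (x, y)) \<cdot>\<^bsub>C\<^esub> psi C x (fst X y) (fst Y y)"
  "x \<in> carrier G \<Longrightarrow> fst (CG_unit G C) x = unit_ob C"
  "\<lbrakk>x \<in> carrier G; y \<in> carrier G\<rbrakk> \<Longrightarrow> snd (CG_unit G C) (x, y) = Idn C (unit_ob C)"
  "x \<in> carrier G \<Longrightarrow> fst (CG_act_ob G g X) x = fst X (x \<otimes>\<^bsub>G\<^esub> g)"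
  "\<lbrakk>x \<in> carrier G; y \<in> carrier G\<rbrakk> \<Longrightarrow> snd (CG_act_ob G g X) (x, y) = snd X (x, y \<otimes>\<^bsub>G\<^esub> g)"
  by (simp_all add: CG_Idn_def CG_Cmp_def CG_tens_ar_def CG_act_ar_def CG_tens_ob_def
      CG_unit_def CG_act_ob_def split_beta)

lemma CG_extensional [simp]:
  "snd (snd (CG_Idn G C X)) \<in> extensional (carrier G)"
  "snd (snd (CG_Cmp G C f' f)) \<in> extensional (carrier G)"
  "snd (snd (CG_tens_ar G C f f')) \<in> extensional (carrier G)"
  "snd (snd (CG_act_ar G g f)) \<in> extensional (carrier G)"
  "fst (CG_tens_ob G C X Y) \<in> extensional (carrier G)"
  "snd (CG_tens_ob G C X Y) \<in> extensional (carrier G \<times> carrier G)"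
  "fst (CG_unit G C) \<in> extensional (carrier G)"
  "snd (CG_unit G C) \<in> extensional (carrier G \<times> carrier G)"
  "fst (CG_act_ob G g X) \<in> extensional (carrier G)"
  "snd (CG_act_ob G g X) \<in> extensional (carrier G \<times> carrier G)"
  by (simp_all add: CG_Idn_def CG_Cmp_def CG_tens_ar_def CG_act_ar_def CG_tens_ob_def
      CG_unit_def CG_act_ob_def split_beta)

lemma CG_Ob_eqI:
  assumes "X \<in> CG_Ob G C" "Y \<in> CG_Ob G C"
    and fam: "\<And>x. x \<in> carrier G \<Longrightarrow> fst X x = fst Y x"
    and iso: "\<And>x y. \<lbrakk>x \<in> carrier G; y \<in> carrier G\<rbrakk> \<Longrightarrow> snd X (x, y) = snd Y (x, y)"
  shows "X = Y"
proof (rule prod_eqI)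
  show "fst X = fst Y"
    using assms(1,2) by (intro extensionalityI[OF _ _ fam]) (auto simp: CG_Ob_def)
  show "snd X = snd Y"
    using assms(1,2) iso
    by (intro extensionalityI[where A = "carrier G \<times> carrier G"]) (auto simp: CG_Ob_def)
qed

lemma CG_Ar_eqI:
  assumes "f \<in> CG_Ar G C" "f' \<in> CG_Ar G C"
    and "fst f = fst f'" "fst (snd f) = fst (snd f')"
    and fam: "\<And>x. x \<in> carrier G \<Longrightarrow> snd (snd f) x = snd (snd f') x"
  shows "f = f'"
proof -
  have "snd (snd f) = snd (snd f')"
    using assms(1,2) by (intro extensionalityI[OF _ _ fam]) (auto simp: CG_Ar_def)
  then show ?thesis
    using assms(3,4) by (simp add: prod_eq_iff)
qed

context monoidal_G_category
begin

lemma CG_ObI: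
  assumes "fst X \<in> extensional (carrier G)" "snd X \<in> extensional (carrier G \<times> carrier G)"
    and "\<And>x. x \<in> carrier G \<Longrightarrow> fst X x \<in> Ob C"
    and "\<And>x y. \<lbrakk>x \<in> carrier G; y \<in> carrier G\<rbrakk> \<Longrightarrow>
      snd X (x, y) \<in> Iso C (act C x \<bullet>\<^sub>o fst X y) (fst X (x \<otimes>\<^bsub>G\<^esub> y))"
    and "\<And>x. x \<in> carrier G \<Longrightarrow> snd X (\<one>\<^bsub>G\<^esub>, x) = Idn C (fst X x)"
    and "\<And>x y z. \<lbrakk>x \<in> carrier G; y \<in> carrier G; z \<in> carrier G\<rbrakk> \<Longrightarrow> snd X (x \<otimes>\<^bsub>G\<^esub> y, z) =
      snd X (x, y \<otimes>\<^bsub>G\<^esub> z) \<cdot>\<^bsub>C\<^esub> ((act C x \<bullet>\<^sub>a snd X (y, z)) \<cdot>\<^bsub>C\<^esub> phi C x y (fst X z))"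
  shows "X \<in> CG_Ob G C"
  using assms unfolding CG_Ob_def by (cases X) simp

context
  fixes X assumes X: "X \<in> CG_Ob G C"
begin

lemma CG_fam_Ob [simp]: "x \<in> carrier G \<Longrightarrow> fst X x \<in> Ob C"
  using X by (auto simp: CG_Ob_def)

lemma CG_iso_Iso: "\<lbrakk>x \<in> carrier G; y \<in> carrier G\<rbrakk>
    \<Longrightarrow> snd X (x, y) \<in> Iso C (act C x \<bullet>\<^sub>o fst X y) (fst X (x \<otimes>\<^bsub>G\<^esub> y))"
  using X by (auto simp: CG_Ob_def)

lemma CG_iso_Ar [simp]: "\<lbrakk>x \<in> carrier G; y \<in> carrier G\<rbrakk> \<Longrightarrow> snd X (x, y) \<in> Ar C"
  and CG_iso_Src [simp]: "\<lbrakk>x \<in> carrier G; y \<in> carrier G\<rbrakk>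
    \<Longrightarrow> Src C (snd X (x, y)) = act C x \<bullet>\<^sub>o fst X y"
  and CG_iso_Tgt [simp]: "\<lbrakk>x \<in> carrier G; y \<in> carrier G\<rbrakk>
    \<Longrightarrow> Tgt C (snd X (x, y)) = fst X (x \<otimes>\<^bsub>G\<^esub> y)"
  using CG_iso_Iso[of x y] by (auto simp: Iso_def Hom_def)

lemma CG_iso_one [simp]: "x \<in> carrier G \<Longrightarrow> snd X (\<one>\<^bsub>G\<^esub>, x) = Idn C (fst X x)"
  using X by (auto simp: CG_Ob_def)

lemma CG_iso_mult: "\<lbrakk>x \<in> carrier G; y \<in> carrier G; z \<in> carrier G\<rbrakk>
    \<Longrightarrow> snd X (x \<otimes>\<^bsub>G\<^esub> y, z) = snd X (x, y \<otimes>\<^bsub>G\<^esub> z) \<cdot>\<^bsub>C\<^esub>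
      ((act C x \<bullet>\<^sub>a snd X (y, z)) \<cdot>\<^bsub>C\<^esub> phi C x y (fst X z))"
  using X by (auto simp: CG_Ob_def)

end

lemma CG_ArI:
  assumes "fst f \<in> CG_Ob G C" "fst (snd f) \<in> CG_Ob G C" "snd (snd f) \<in> extensional (carrier G)"
    and "\<And>x. x \<in> carrier G \<Longrightarrow> snd (snd f) x \<in> Hom C (fst (fst f) x) (fst (fst (snd f)) x)"
    and "\<And>x y. \<lbrakk>x \<in> carrier G; y \<in> carrier G\<rbrakk> \<Longrightarrow>
      snd (snd f) (x \<otimes>\<^bsub>G\<^esub> y) \<cdot>\<^bsub>C\<^esub> snd (fst f) (x, y)
        = snd (fst (snd f)) (x, y) \<cdot>\<^bsub>C\<^esub> (act C x \<bullet>\<^sub>a snd (snd f) y)"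
  shows "f \<in> CG_Ar G C"
  using assms unfolding CG_Ar_def by (cases f) auto

context
  fixes f assumes f: "f \<in> CG_Ar G C"
begin

lemma CG_Src [simp]: "fst f \<in> CG_Ob G C"
  and CG_Tgt [simp]: "fst (snd f) \<in> CG_Ob G C"
  using f by (auto simp: CG_Ar_def)

lemma CG_fam_Ar [simp]: "x \<in> carrier G \<Longrightarrow> snd (snd f) x \<in> Ar C"
  and CG_fam_Src [simp]: "x \<in> carrier G \<Longrightarrow> Src C (snd (snd f) x) = fst (fst f) x"
  and CG_fam_Tgt [simp]: "x \<in> carrier G \<Longrightarrow> Tgt C (snd (snd f) x) = fst (fst (snd f)) x"
  using f by (auto simp: CG_Ar_def Hom_def)

lemma CG_fam_natural: "\<lbrakk>x \<in> carrier G; y \<in> carrier G\<rbrakk> \<Longrightarrow>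
    snd (snd f) (x \<otimes>\<^bsub>G\<^esub> y) \<cdot>\<^bsub>C\<^esub> snd (fst f) (x, y)
      = snd (fst (snd f)) (x, y) \<cdot>\<^bsub>C\<^esub> (act C x \<bullet>\<^sub>a snd (snd f) y)"
  using f by (auto simp: CG_Ar_def)

end

lemma CG_Idn_Ar [simp]: "X \<in> CG_Ob G C \<Longrightarrow> CG_Idn G C X \<in> CG_Ar G C"
  by (rule CG_ArI) (simp_all add: Hom_def)

lemma CG_Cmp_Ar [simp]:
  assumes f: "f \<in> CG_Ar G C" and f': "f' \<in> CG_Ar G C" and [simp]: "fst (snd f) = fst f'"
  shows "CG_Cmp G C f' f \<in> CG_Ar G C"
proof (rule CG_ArI)
  note [simp] = f f'
  have [simp]: "fst f' \<in> CG_Ob G C" "fst (snd f') \<in> CG_Ob G C"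
    by simp_all
  fix x y assume xy: "x \<in> carrier G" "y \<in> carrier G"
  let ?f = "snd (snd f)" and ?f' = "snd (snd f')"
  have "(?f' (x \<otimes>\<^bsub>G\<^esub> y) \<cdot>\<^bsub>C\<^esub> ?f (x \<otimes>\<^bsub>G\<^esub> y)) \<cdot>\<^bsub>C\<^esub> snd (fst f) (x, y)
      = (?f' (x \<otimes>\<^bsub>G\<^esub> y) \<cdot>\<^bsub>C\<^esub> snd (fst f') (x, y)) \<cdot>\<^bsub>C\<^esub> (act C x \<bullet>\<^sub>a ?f y)"
    using xy CG_fam_natural[OF f, of x y] by (simp add: Cmp_assoc_Ar)
  also have "\<dots> = snd (fst (snd f')) (x, y) \<cdot>\<^bsub>C\<^esub> (act C x \<bullet>\<^sub>a (?f' y \<cdot>\<^bsub>C\<^esub> ?f y))"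
    using xy CG_fam_natural[OF f', of x y] by (simp add: Cmp_assoc_Ar act_Cmp)
  finally show "snd (snd (CG_Cmp G C f' f)) (x \<otimes>\<^bsub>G\<^esub> y) \<cdot>\<^bsub>C\<^esub> snd (fst (CG_Cmp G C f' f)) (x, y)
      = snd (fst (snd (CG_Cmp G C f' f))) (x, y) \<cdot>\<^bsub>C\<^esub> (act C x \<bullet>\<^sub>a snd (snd (CG_Cmp G C f' f)) y)"
    using xy by simp
qed (use assms in \<open>auto simp: Hom_def\<close>)

lemma CG_category: "category (CG G C)"
proof
  fix f X Y assume "f \<in> Hom (CG G C) X Y"
  then have "f \<in> CG_Ar G C" "fst f = X" "fst (snd f) = Y" by (auto simp: Hom_def)
  then show "f \<cdot>\<^bsub>CG G C\<^esub> Idn (CG G C) X = f" "Idn (CG G C) Y \<cdot>\<^bsub>CG G C\<^esub> f = f"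
    by (auto intro!: CG_Ar_eqI[of _ G C])
next
  fix f g h W X Y Z
  assume "f \<in> Hom (CG G C) W X" "g \<in> Hom (CG G C) X Y" "h \<in> Hom (CG G C) Y Z"
  then have "f \<in> CG_Ar G C" "g \<in> CG_Ar G C" "h \<in> CG_Ar G C"
    "fst (snd f) = fst g" "fst (snd g) = fst h" by (auto simp: Hom_def)
  then show "(h \<cdot>\<^bsub>CG G C\<^esub> g) \<cdot>\<^bsub>CG G C\<^esub> f = h \<cdot>\<^bsub>CG G C\<^esub> (g \<cdot>\<^bsub>CG G C\<^esub> f)"
    by (auto intro!: CG_Ar_eqI[of _ G C] simp: Cmp_assoc_Ar)
qed (auto simp: Hom_def)

lemma CG_unit_Ob [simp]: "CG_unit G C \<in> CG_Ob G C"
  by (rule CG_ObI) (simp_all add: Iso_Idn)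

text \<open>For the cocycle condition, split \<open>\<eta>\<^sub>x\<^sub>y\<^sub>,\<^sub>z \<otimes> \<eta>'\<^sub>x\<^sub>y\<^sub>,\<^sub>z\<close> by the cocycle conditions of both factors,
  exchange \<open>(\<phi> \<otimes> \<phi>) \<psi>\<^sup>x\<^sup>y\<close> for \<open>\<psi>\<^sup>x x\<^sub>*(\<psi>\<^sup>y) \<phi>\<close>, and move \<open>\<psi>\<^sup>x\<close> past \<open>x\<^sub>*(\<eta>) \<otimes> x\<^sub>*(\<eta>')\<close> by naturality.\<close>

lemma CG_tens_Ob [simp]:
  assumes X [simp]: "X \<in> CG_Ob G C" and Y [simp]: "Y \<in> CG_Ob G C"
  shows "CG_tens_ob G C X Y \<in> CG_Ob G C"
proof (rule CG_ObI)
  fix x y assume "x \<in> carrier G" "y \<in> carrier G"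
  then show "snd (CG_tens_ob G C X Y) (x, y)
      \<in> Iso C (act C x \<bullet>\<^sub>o fst (CG_tens_ob G C X Y) y) (fst (CG_tens_ob G C X Y) (x \<otimes>\<^bsub>G\<^esub> y))"
    by (auto intro!: Iso_Cmp[OF psi_Iso] tens_Iso CG_iso_Iso)
next
  fix x y z assume xyz [simp]: "x \<in> carrier G" "y \<in> carrier G" "z \<in> carrier G"
  let ?p = "snd X" and ?q = "snd Y" and ?L = "fst X" and ?M = "fst Y"
  have "snd (CG_tens_ob G C X Y) (x \<otimes>\<^bsub>G\<^esub> y, z)
      = ((?p (x, y \<otimes>\<^bsub>G\<^esub> z) \<boxtimes>\<^sub>a\<^bsub>C\<^esub> ?q (x, y \<otimes>\<^bsub>G\<^esub> z)) \<cdot>\<^bsub>C\<^esub>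
          ((act C x \<bullet>\<^sub>a ?p (y, z)) \<boxtimes>\<^sub>a\<^bsub>C\<^esub> (act C x \<bullet>\<^sub>a ?q (y, z)))) \<cdot>\<^bsub>C\<^esub>
        ((phi C x y (?L z) \<boxtimes>\<^sub>a\<^bsub>C\<^esub> phi C x y (?M z)) \<cdot>\<^bsub>C\<^esub> psi C (x \<otimes>\<^bsub>G\<^esub> y) (?L z) (?M z))"
    by (simp add: CG_iso_mult m_assoc Cmp_assoc_Ar flip: tens_Cmp)
  also have "\<dots> = (?p (x, y \<otimes>\<^bsub>G\<^esub> z) \<boxtimes>\<^sub>a\<^bsub>C\<^esub> ?q (x, y \<otimes>\<^bsub>G\<^esub> z)) \<cdot>\<^bsub>C\<^esub>
        ((((act C x \<bullet>\<^sub>a ?p (y, z)) \<boxtimes>\<^sub>a\<^bsub>C\<^esub> (act C x \<bullet>\<^sub>a ?q (y, z))) \<cdot>\<^bsub>C\<^esub>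
            psi C x (act C y \<bullet>\<^sub>o ?L z) (act C y \<bullet>\<^sub>o ?M z)) \<cdot>\<^bsub>C\<^esub>
          ((act C x \<bullet>\<^sub>a psi C y (?L z) (?M z)) \<cdot>\<^bsub>C\<^esub> phi C x y (?L z \<boxtimes>\<^sub>o\<^bsub>C\<^esub> ?M z)))"
    by (simp add: phi_psi Cmp_assoc_Ar m_assoc)
  also have "\<dots> = (?p (x, y \<otimes>\<^bsub>G\<^esub> z) \<boxtimes>\<^sub>a\<^bsub>C\<^esub> ?q (x, y \<otimes>\<^bsub>G\<^esub> z)) \<cdot>\<^bsub>C\<^esub>
        ((psi C x (?L (y \<otimes>\<^bsub>G\<^esub> z)) (?M (y \<otimes>\<^bsub>G\<^esub> z)) \<cdot>\<^bsub>C\<^esub>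
            (act C x \<bullet>\<^sub>a (?p (y, z) \<boxtimes>\<^sub>a\<^bsub>C\<^esub> ?q (y, z)))) \<cdot>\<^bsub>C\<^esub>
          ((act C x \<bullet>\<^sub>a psi C y (?L z) (?M z)) \<cdot>\<^bsub>C\<^esub> phi C x y (?L z \<boxtimes>\<^sub>o\<^bsub>C\<^esub> ?M z)))"
    using psi_natural[of x "?p (y, z)" "?q (y, z)"] by simp
  also have "\<dots> = snd (CG_tens_ob G C X Y) (x, y \<otimes>\<^bsub>G\<^esub> z) \<cdot>\<^bsub>C\<^esub>
      ((act C x \<bullet>\<^sub>a snd (CG_tens_ob G C X Y) (y, z)) \<cdot>\<^bsub>C\<^esub> phi C x y (fst (CG_tens_ob G C X Y) z))"
    by (simp add: act_Cmp Cmp_assoc_Ar m_assoc)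
  finally show "snd (CG_tens_ob G C X Y) (x \<otimes>\<^bsub>G\<^esub> y, z) =
      snd (CG_tens_ob G C X Y) (x, y \<otimes>\<^bsub>G\<^esub> z) \<cdot>\<^bsub>C\<^esub>
      ((act C x \<bullet>\<^sub>a snd (CG_tens_ob G C X Y) (y, z)) \<cdot>\<^bsub>C\<^esub> phi C x y (fst (CG_tens_ob G C X Y) z))" .
qed simp_all

lemma CG_tens_Ar [simp]:
  assumes f [simp]: "f \<in> CG_Ar G C" and f' [simp]: "f' \<in> CG_Ar G C"
  shows "CG_tens_ar G C f f' \<in> CG_Ar G C"
proof (rule CG_ArI)
  fix x y assume xy [simp]: "x \<in> carrier G" "y \<in> carrier G"
  let ?f = "snd (snd f)" and ?f' = "snd (snd f')"
  have "(?f (x \<otimes>\<^bsub>G\<^esub> y) \<boxtimes>\<^sub>a\<^bsub>C\<^esub> ?f' (x \<otimes>\<^bsub>G\<^esub> y)) \<cdot>\<^bsub>C\<^esub> snd (CG_tens_ob G C (fst f) (fst f')) (x, y)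
      = ((snd (fst (snd f)) (x, y) \<cdot>\<^bsub>C\<^esub> (act C x \<bullet>\<^sub>a ?f y)) \<boxtimes>\<^sub>a\<^bsub>C\<^esub>
          (snd (fst (snd f')) (x, y) \<cdot>\<^bsub>C\<^esub> (act C x \<bullet>\<^sub>a ?f' y))) \<cdot>\<^bsub>C\<^esub>
        psi C x (fst (fst f) y) (fst (fst f') y)"
    by (simp add: tens_Cmp CG_fam_natural flip: Cmp_assoc_Ar)
  also have "\<dots> = (snd (fst (snd f)) (x, y) \<boxtimes>\<^sub>a\<^bsub>C\<^esub> snd (fst (snd f')) (x, y)) \<cdot>\<^bsub>C\<^esub>
        (((act C x \<bullet>\<^sub>a ?f y) \<boxtimes>\<^sub>a\<^bsub>C\<^esub> (act C x \<bullet>\<^sub>a ?f' y)) \<cdot>\<^bsub>C\<^esub>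
        psi C x (fst (fst f) y) (fst (fst f') y))"
    by (simp add: Cmp_assoc_Ar flip: tens_Cmp)
  also have "\<dots> = snd (CG_tens_ob G C (fst (snd f)) (fst (snd f'))) (x, y) \<cdot>\<^bsub>C\<^esub>
      (act C x \<bullet>\<^sub>a (?f y \<boxtimes>\<^sub>a\<^bsub>C\<^esub> ?f' y))"
    using psi_natural[of x "?f y" "?f' y"] by (simp add: Cmp_assoc_Ar)
  finally show "snd (snd (CG_tens_ar G C f f')) (x \<otimes>\<^bsub>G\<^esub> y) \<cdot>\<^bsub>C\<^esub>
        snd (fst (CG_tens_ar G C f f')) (x, y)
      = snd (fst (snd (CG_tens_ar G C f f'))) (x, y) \<cdot>\<^bsub>C\<^esub>
        (act C x \<bullet>\<^sub>a snd (snd (CG_tens_ar G C f f')) y)"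
    by simp
qed (simp_all add: Hom_def)

text \<open>The underlying families agree because \<open>C\<close> is strict; on structure isomorphisms the two sides
  differ by the two sides of the associativity axiom for \<open>\<psi>\<^sup>x\<close>.\<close>

lemma CG_tens_assoc:
  assumes X [simp]: "X \<in> CG_Ob G C" and Y [simp]: "Y \<in> CG_Ob G C" and Z [simp]: "Z \<in> CG_Ob G C"
  shows "CG_tens_ob G C (CG_tens_ob G C X Y) Z = CG_tens_ob G C X (CG_tens_ob G C Y Z)"
proof (rule CG_Ob_eqI[of _ G C])
  fix x y assume [simp]: "x \<in> carrier G" "y \<in> carrier G"
  let ?p = "snd X (x, y)" and ?q = "snd Y (x, y)" and ?r = "snd Z (x, y)"
  let ?L = "fst X y" and ?M = "fst Y y" and ?N = "fst Z y"
  have "snd (CG_tens_ob G C (CG_tens_ob G C X Y) Z) (x, y)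
      = ((?p \<boxtimes>\<^sub>a\<^bsub>C\<^esub> ?q) \<boxtimes>\<^sub>a\<^bsub>C\<^esub> ?r) \<cdot>\<^bsub>C\<^esub>
        ((psi C x ?L ?M \<boxtimes>\<^sub>a\<^bsub>C\<^esub> Idn C (act C x \<bullet>\<^sub>o ?N)) \<cdot>\<^bsub>C\<^esub> psi C x (?L \<boxtimes>\<^sub>o\<^bsub>C\<^esub> ?M) ?N)"
    by (simp add: tens_Cmp flip: Cmp_assoc_Ar)
  also have "\<dots> = (?p \<boxtimes>\<^sub>a\<^bsub>C\<^esub> (?q \<boxtimes>\<^sub>a\<^bsub>C\<^esub> ?r)) \<cdot>\<^bsub>C\<^esub>
        ((Idn C (act C x \<bullet>\<^sub>o ?L) \<boxtimes>\<^sub>a\<^bsub>C\<^esub> psi C x ?M ?N) \<cdot>\<^bsub>C\<^esub> psi C x ?L (?M \<boxtimes>\<^sub>o\<^bsub>C\<^esub> ?N))"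
    by (simp add: psi_psi tens_ar_assoc)
  also have "\<dots> = snd (CG_tens_ob G C X (CG_tens_ob G C Y Z)) (x, y)"
    by (simp add: tens_Cmp flip: Cmp_assoc_Ar)
  finally show "snd (CG_tens_ob G C (CG_tens_ob G C X Y) Z) (x, y)
      = snd (CG_tens_ob G C X (CG_tens_ob G C Y Z)) (x, y)" .
qed (simp_all add: tens_ob_assoc)

lemma CG_unit_tens [simp]: "X \<in> CG_Ob G C \<Longrightarrow> CG_tens_ob G C (CG_unit G C) X = X"
  and CG_tens_unit [simp]: "X \<in> CG_Ob G C \<Longrightarrow> CG_tens_ob G C X (CG_unit G C) = X"
  by (auto intro!: CG_Ob_eqI[of _ G C])

lemma CG_monoidal_category: "monoidal_category (CG G C)"
proof (intro monoidal_category.intro monoidal_category_axioms.intro CG_category)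
  fix f f' f'' g g' X X' X'' Y Y' Y''
  assume "f \<in> Hom (CG G C) X X'" "f' \<in> Hom (CG G C) X' X''"
    "g \<in> Hom (CG G C) Y Y'" "g' \<in> Hom (CG G C) Y' Y''"
  then have "f \<in> CG_Ar G C" "f' \<in> CG_Ar G C" "g \<in> CG_Ar G C" "g' \<in> CG_Ar G C"
    "fst (snd f) = fst f'" "fst (snd g) = fst g'" by (auto simp: Hom_def)
  then show "(f' \<cdot>\<^bsub>CG G C\<^esub> f) \<boxtimes>\<^sub>a\<^bsub>CG G C\<^esub> (g' \<cdot>\<^bsub>CG G C\<^esub> g)
      = (f' \<boxtimes>\<^sub>a\<^bsub>CG G C\<^esub> g') \<cdot>\<^bsub>CG G C\<^esub> (f \<boxtimes>\<^sub>a\<^bsub>CG G C\<^esub> g)"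
    by (auto intro!: CG_Ar_eqI[of _ G C] simp: tens_Cmp)
next
  fix X Y assume "X \<in> Ob (CG G C)" "Y \<in> Ob (CG G C)"
  then show "Idn (CG G C) X \<boxtimes>\<^sub>a\<^bsub>CG G C\<^esub> Idn (CG G C) Y = Idn (CG G C) (X \<boxtimes>\<^sub>o\<^bsub>CG G C\<^esub> Y)"
    by (auto intro!: CG_Ar_eqI[of _ G C])
next
  fix f g h assume "f \<in> Ar (CG G C)" "g \<in> Ar (CG G C)" "h \<in> Ar (CG G C)"
  then show "(f \<boxtimes>\<^sub>a\<^bsub>CG G C\<^esub> g) \<boxtimes>\<^sub>a\<^bsub>CG G C\<^esub> h = f \<boxtimes>\<^sub>a\<^bsub>CG G C\<^esub> (g \<boxtimes>\<^sub>a\<^bsub>CG G C\<^esub> h)"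
    by (auto intro!: CG_Ar_eqI[of _ G C] simp: CG_tens_assoc tens_ar_assoc)
next
  fix f assume "f \<in> Ar (CG G C)"
  then show "Idn (CG G C) (unit_ob (CG G C)) \<boxtimes>\<^sub>a\<^bsub>CG G C\<^esub> f = f"
    "f \<boxtimes>\<^sub>a\<^bsub>CG G C\<^esub> Idn (CG G C) (unit_ob (CG G C)) = f"
    by (auto intro!: CG_Ar_eqI[of _ G C])
qed (auto simp: Hom_def CG_tens_assoc)

lemma CG_act_Ob [simp]:
  "\<lbrakk>g \<in> carrier G; X \<in> CG_Ob G C\<rbrakk> \<Longrightarrow> CG_act_ob G g X \<in> CG_Ob G C"
  using CG_iso_Iso[of X _ "_ \<otimes>\<^bsub>G\<^esub> g"] by (intro CG_ObI) (simp_all add: CG_iso_mult m_assoc)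

lemma CG_act_Ar [simp]:
  "\<lbrakk>g \<in> carrier G; f \<in> CG_Ar G C\<rbrakk> \<Longrightarrow> CG_act_ar G g f \<in> CG_Ar G C"
  using CG_fam_natural[of f _ "_ \<otimes>\<^bsub>G\<^esub> g"] by (intro CG_ArI) (simp_all add: Hom_def m_assoc)

lemma CG_act_one [simp]: "X \<in> CG_Ob G C \<Longrightarrow> CG_act_ob G \<one>\<^bsub>G\<^esub> X = X"
  and CG_act_act [simp]: "\<lbrakk>g \<in> carrier G; h \<in> carrier G; X \<in> CG_Ob G C\<rbrakk>
    \<Longrightarrow> CG_act_ob G g (CG_act_ob G h X) = CG_act_ob G (g \<otimes>\<^bsub>G\<^esub> h) X"
  and CG_act_unit [simp]: "g \<in> carrier G \<Longrightarrow> CG_act_ob G g (CG_unit G C) = CG_unit G C"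
  and CG_act_tens [simp]: "\<lbrakk>g \<in> carrier G; X \<in> CG_Ob G C; Y \<in> CG_Ob G C\<rbrakk>
    \<Longrightarrow> CG_tens_ob G C (CG_act_ob G g X) (CG_act_ob G g Y) = CG_act_ob G g (CG_tens_ob G C X Y)"
  by (auto intro!: CG_Ob_eqI[of _ G C] simp: m_assoc)

lemma CG_act_functor: "g \<in> carrier G \<Longrightarrow> cat_functor (CG G C) (CG G C) (act (CG G C) g)"
  by (intro cat_functor.intro cat_functor_axioms.intro CG_category)
    (auto simp: Hom_def intro!: CG_Ar_eqI[of _ G C])

lemma CG_Idn_Iso: "X \<in> CG_Ob G C \<Longrightarrow> CG_Idn G C X \<in> Iso (CG G C) X X"
  using category.Iso_Idn[OF CG_category] by simp

lemma CG_Cmp_Idn [simp]: "\<lbrakk>f \<in> CG_Ar G C; fst f = X\<rbrakk> \<Longrightarrow> CG_Cmp G C f (CG_Idn G C X) = f"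
  and CG_Idn_Cmp [simp]: "\<lbrakk>f \<in> CG_Ar G C; fst (snd f) = X\<rbrakk> \<Longrightarrow> CG_Cmp G C (CG_Idn G C X) f = f"
  by (auto intro!: CG_Ar_eqI[of _ G C])

lemma CG_tens_Idn [simp]: "\<lbrakk>X \<in> CG_Ob G C; Y \<in> CG_Ob G C\<rbrakk>
    \<Longrightarrow> CG_tens_ar G C (CG_Idn G C X) (CG_Idn G C Y) = CG_Idn G C (CG_tens_ob G C X Y)"
  and CG_act_Idn [simp]: "\<lbrakk>g \<in> carrier G; X \<in> CG_Ob G C\<rbrakk>
    \<Longrightarrow> CG_act_ar G g (CG_Idn G C X) = CG_Idn G C (CG_act_ob G g X)"
  by (auto intro!: CG_Ar_eqI[of _ G C])

lemma CG_act_ar_act [simp]: "\<lbrakk>g \<in> carrier G; h \<in> carrier G; f \<in> CG_Ar G C\<rbrakk>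
    \<Longrightarrow> CG_act_ar G g (CG_act_ar G h f) = CG_act_ar G (g \<otimes>\<^bsub>G\<^esub> h) f"
  and CG_act_ar_one [simp]: "f \<in> CG_Ar G C \<Longrightarrow> CG_act_ar G \<one>\<^bsub>G\<^esub> f = f"
  and CG_act_ar_tens [simp]: "\<lbrakk>g \<in> carrier G; f \<in> CG_Ar G C; f' \<in> CG_Ar G C\<rbrakk>
    \<Longrightarrow> CG_tens_ar G C (CG_act_ar G g f) (CG_act_ar G g f') = CG_act_ar G g (CG_tens_ar G C f f')"
  by (auto intro!: CG_Ar_eqI[of _ G C] simp: m_assoc)

lemma CG_strict_monoidal_G_category: "strict_monoidal_G_category G (CG G C)"
proof (intro strict_monoidal_G_category.intro strict_monoidal_G_category_axioms.intro
    monoidal_G_category.intro monoidal_G_category_axioms.intro CG_monoidal_category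
    CG_act_functor is_group)
  fix g h assume gh [simp]: "g \<in> carrier G" "h \<in> carrier G"
  show "nat_iso (CG G C) (CG G C) (act (CG G C) (g \<otimes>\<^bsub>G\<^esub> h))
      (fctr_comp (act (CG G C) g) (act (CG G C) h)) (phi (CG G C) g h)"
    by (intro nat_iso.intro nat_iso_axioms.intro nat_trans.intro nat_trans_axioms.intro
        cat_functor_comp[OF CG_act_functor CG_act_functor] CG_act_functor)
      (auto simp: fctr_comp_def Hom_def CG_Idn_Iso)
next
  fix g assume [simp]: "g \<in> carrier G"
  show "tens_nat_iso (CG G C) (CG G C) (act (CG G C) g) (psi (CG G C) g)"
    by (auto simp: tens_nat_iso_def Hom_def CG_Idn_Iso)
qed (simp_all add: m_assoc CG_tens_assoc)

section \<open>Evaluation at the unit as a monoidal \<open>G\<close>-functor\<close>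

text \<open>This is used twice: for \<open>C\<close> and, since \<open>C(G)\<close> is itself a monoidal \<open>G\<close>-category, for \<open>C(G)\<close>.
  It supplies the monoidal structures on \<open>g\<^sub>* \<circ> U\<^sub>e\<close> and \<open>U\<^sub>e \<circ> g\<^sub>*\<close>.\<close>

lemma mon_act_monoidal_functor:
  assumes [simp]: "g \<in> carrier G"
  shows "monoidal_functor C C (mon_act C g)"
proof -
  have sel [simp]: "mon_act C g \<bullet>\<^sub>o X = act C g \<bullet>\<^sub>o X" "mon_act C g \<bullet>\<^sub>a f = act C g \<bullet>\<^sub>a f"
    "fctr2 (mon_act C g) X Y = psi C g X Y" "fctr0 (mon_act C g) = Idn C (unit_ob C)" for X Y f
    by (simp_all add: mon_act_def)
  show ?thesis
    by unfold_locales
      (use psi_nat_iso[of g] in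
        \<open>auto simp: Hom_def act_Cmp tens_nat_iso_def psi_psi Iso_Idn\<close>)
qed

lemma U_e_functor: "cat_functor (CG G C) C (U_e G C)"
  by (intro cat_functor.intro cat_functor_axioms.intro CG_category category_axioms)
    (auto simp: Hom_def)

lemma U_e_monoidal_functor: "monoidal_functor (CG G C) C (U_e G C)"
  by (intro monoidal_functor.intro monoidal_functor_axioms.intro U_e_functor
      CG_monoidal_category monoidal_category_axioms)
    (auto simp: Hom_def tens_nat_iso_def Iso_Idn tens_ob_assoc)

lemma U_e_strict_monoidal_functor: "strict_monoidal_functor (CG G C) C (U_e G C)"
  by (intro strict_monoidal_functor.intro strict_monoidal_functor_axioms.intro
      U_e_monoidal_functor) simp_all

lemma U_e_monoidal_G_functor: "monoidal_G_functor G (CG G C) C (U_e G C) (gamma G)"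
proof -
  interpret CG: strict_monoidal_G_category G "CG G C"
    by (rule CG_strict_monoidal_G_category)
  show ?thesis
  proof (intro monoidal_G_functor.intro monoidal_G_functor_axioms.intro
      U_e_monoidal_functor CG.monoidal_G_category_axioms monoidal_G_category_axioms)
    fix g assume g [simp]: "g \<in> carrier G"
    let ?gU = "mon_fctr_comp C (mon_act C g) (U_e G C)"
    let ?Ug = "mon_fctr_comp C (U_e G C) (mon_act (CG G C) g)"
    have gU: "monoidal_functor (CG G C) C ?gU"
      by (rule monoidal_functor_comp[OF U_e_monoidal_functor mon_act_monoidal_functor[OF g]])
    have Ug: "monoidal_functor (CG G C) C ?Ug"
      by (rule monoidal_functor_comp[OF CG.mon_act_monoidal_functor[OF g] U_e_monoidal_functor])
    show "monoidal_nat_iso (CG G C) C ?gU ?Ug (gamma G g)"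
      by (intro monoidal_nat_iso.intro nat_iso.intro nat_iso_axioms.intro nat_trans.intro
          nat_trans_axioms.intro monoidal_nat_trans.intro monoidal_nat_trans_axioms.intro
          gU Ug gU[THEN monoidal_functor.axioms(1)] Ug[THEN monoidal_functor.axioms(1)])
        (use CG_iso_Iso[of _ g "\<one>\<^bsub>G\<^esub>"] CG_fam_natural[of _ g "\<one>\<^bsub>G\<^esub>"] in
          \<open>auto simp: mon_fctr_comp_def mon_act_def Hom_def\<close>)
  next
    fix g h X assume "g \<in> carrier G" "h \<in> carrier G" "X \<in> Ob (CG G C)"
    then show "(U_e G C \<bullet>\<^sub>a phi (CG G C) g h X) \<cdot>\<^bsub>C\<^esub> gamma G (g \<otimes>\<^bsub>G\<^esub> h) X =
        gamma G g (act (CG G C) h \<bullet>\<^sub>o X) \<cdot>\<^bsub>C\<^esub>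
        ((act C g \<bullet>\<^sub>a gamma G h X) \<cdot>\<^bsub>C\<^esub> phi C g h (U_e G C \<bullet>\<^sub>o X))"
      using CG_iso_mult[of X g h "\<one>\<^bsub>G\<^esub>"] by (simp add: m_assoc)
  qed simp_all
qed

end

section \<open>Evaluation at the unit is an equivalence\<close>

text \<open>The isomorphism \<open>\<phi>(g, h)\<^sub>X\<close> runs from \<open>(gh)\<^sub>*(X)\<close> to \<open>g\<^sub>*(h\<^sub>*(X))\<close>, against the direction required
  of a structure isomorphism of \<open>C(G)\<close>; hence the inverse.\<close>

definition orbit_ob :: "('g, 'b) monoid_scheme \<Rightarrow> ('o, 'm, 'g, 'z) gcat_scheme
    \<Rightarrow> 'o \<Rightarrow> ('o, 'm, 'g) CG_ob" where
  "orbit_ob G C X = (\<lambda>g \<in> carrier G. act C g \<bullet>\<^sub>o X,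
     \<lambda>(g, h) \<in> carrier G \<times> carrier G. inv_ar C (phi C g h X))"

definition orbit_ar :: "('g, 'b) monoid_scheme \<Rightarrow> ('o, 'm, 'g, 'z) gcat_scheme
    \<Rightarrow> 'm \<Rightarrow> ('o, 'm, 'g) CG_ar" where
  "orbit_ar G C f =
     (orbit_ob G C (Src C f), orbit_ob G C (Tgt C f), \<lambda>g \<in> carrier G. act C g \<bullet>\<^sub>a f)"

definition orbit :: "('g, 'b) monoid_scheme \<Rightarrow> ('o, 'm, 'g, 'z) gcat_scheme
    \<Rightarrow> ('o, 'm, ('o, 'm, 'g) CG_ob, ('o, 'm, 'g) CG_ar) fctr" where
  "orbit G C = \<lparr>ob_map = orbit_ob G C, ar_map = orbit_ar G C\<rparr>"

text \<open>The counit of the equivalence. Its components are the arrows \<open>\<gamma>(g)\<close>, here with \<open>g\<close> as the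
  index of a family.\<close>

definition orbit_to_family :: "('g, 'b) monoid_scheme \<Rightarrow> ('o, 'm, 'g, 'z) gcat_scheme
    \<Rightarrow> ('o, 'm, 'g) CG_ob \<Rightarrow> ('o, 'm, 'g) CG_ar" where
  "orbit_to_family G C X =
     (orbit_ob G C (fst X \<one>\<^bsub>G\<^esub>), X, \<lambda>g \<in> carrier G. snd X (g, \<one>\<^bsub>G\<^esub>))"

lemma orbit_sel [simp]:
  "orbit G C \<bullet>\<^sub>o X = orbit_ob G C X" "orbit G C \<bullet>\<^sub>a f = orbit_ar G C f"
  "x \<in> carrier G \<Longrightarrow> fst (orbit_ob G C X) x = act C x \<bullet>\<^sub>o X"
  "\<lbrakk>x \<in> carrier G; y \<in> carrier G\<rbrakk> \<Longrightarrow> snd (orbit_ob G C X) (x, y) = inv_ar C (phi C x y X)"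
  "fst (orbit_ob G C X) \<in> extensional (carrier G)"
  "snd (orbit_ob G C X) \<in> extensional (carrier G \<times> carrier G)"
  "fst (orbit_ar G C f) = orbit_ob G C (Src C f)"
  "fst (snd (orbit_ar G C f)) = orbit_ob G C (Tgt C f)"
  "x \<in> carrier G \<Longrightarrow> snd (snd (orbit_ar G C f)) x = act C x \<bullet>\<^sub>a f"
  "snd (snd (orbit_ar G C f)) \<in> extensional (carrier G)"
  "fst (orbit_to_family G C Y) = orbit_ob G C (fst Y \<one>\<^bsub>G\<^esub>)"
  "fst (snd (orbit_to_family G C Y)) = Y"
  "x \<in> carrier G \<Longrightarrow> snd (snd (orbit_to_family G C Y)) x = snd Y (x, \<one>\<^bsub>G\<^esub>)"
  "snd (snd (orbit_to_family G C Y)) \<in> extensional (carrier G)"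
  by (simp_all add: orbit_def orbit_ob_def orbit_ar_def orbit_to_family_def)

context monoidal_G_category
begin

text \<open>The inverses of the components satisfy the condition on arrows of \<open>C(G)\<close> because that condition
  is a commuting square, whose sides formed by the components can be inverted.\<close>

lemma CG_IsoI:
  assumes f [simp]: "f \<in> CG_Ar G C"
    and iso: "\<And>x. x \<in> carrier G \<Longrightarrow>
      snd (snd f) x \<in> Iso C (fst (fst f) x) (fst (fst (snd f)) x)"
  shows "f \<in> Iso (CG G C) (fst f) (fst (snd f))"
proof -
  define f' where "f' = (fst (snd f), fst f, \<lambda>x \<in> carrier G. inv_ar C (snd (snd f) x))"
  have f'_sel [simp]: "fst f' = fst (snd f)" "fst (snd f') = fst f"
    "x \<in> carrier G \<Longrightarrow> snd (snd f') x = inv_ar C (snd (snd f) x)"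
    "snd (snd f') \<in> extensional (carrier G)" for x
    by (simp_all add: f'_def)
  have [simp]: "f' \<in> CG_Ar G C"
  proof (rule CG_ArI)
    fix x y assume [simp]: "x \<in> carrier G" "y \<in> carrier G"
    note fy = inv_ar[OF iso[of y]] and fxy = inv_ar[OF iso[of "x \<otimes>\<^bsub>G\<^esub> y"]]
    have "inv_ar C (snd (snd f) (x \<otimes>\<^bsub>G\<^esub> y)) \<cdot>\<^bsub>C\<^esub> snd (fst (snd f)) (x, y)
        = snd (fst f) (x, y) \<cdot>\<^bsub>C\<^esub> (act C x \<bullet>\<^sub>a inv_ar C (snd (snd f) y))"
    proof (rule square_invert)
      show "snd (snd f) (x \<otimes>\<^bsub>G\<^esub> y) \<cdot>\<^bsub>C\<^esub> snd (fst f) (x, y)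
          = snd (fst (snd f)) (x, y) \<cdot>\<^bsub>C\<^esub> (act C x \<bullet>\<^sub>a snd (snd f) y)"
        by (simp add: CG_fam_natural)
      show "(act C x \<bullet>\<^sub>a snd (snd f) y) \<cdot>\<^bsub>C\<^esub> (act C x \<bullet>\<^sub>a inv_ar C (snd (snd f) y))
          = Idn C (act C x \<bullet>\<^sub>o fst (fst (snd f)) y)"
        using fy by (simp add: Hom_def flip: act_Cmp)
    qed (use fy fxy in \<open>simp_all add: Hom_def\<close>)
    then show "snd (snd f') (x \<otimes>\<^bsub>G\<^esub> y) \<cdot>\<^bsub>C\<^esub> snd (fst f') (x, y)
        = snd (fst (snd f')) (x, y) \<cdot>\<^bsub>C\<^esub> (act C x \<bullet>\<^sub>a snd (snd f') y)"
      by simp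
  qed (use iso in \<open>auto intro: inv_ar_Hom\<close>)
  show ?thesis
  proof (rule category.IsoI[OF CG_category, where g = f'])
    show "f' \<cdot>\<^bsub>CG G C\<^esub> f = Idn (CG G C) (fst f)"
      by (auto intro!: CG_Ar_eqI[of _ G C] inv_ar_Cmp iso)
    show "f \<cdot>\<^bsub>CG G C\<^esub> f' = Idn (CG G C) (fst (snd f))"
      by (auto intro!: CG_Ar_eqI[of _ G C] Cmp_inv_ar iso)
  qed (simp_all add: Hom_def)
qed

lemma inv_phi_Ar [simp]: "\<lbrakk>g \<in> carrier G; h \<in> carrier G; X \<in> Ob C\<rbrakk> \<Longrightarrow> inv_ar C (phi C g h X) \<in> Ar C"
  and inv_phi_Src [simp]: "\<lbrakk>g \<in> carrier G; h \<in> carrier G; X \<in> Ob C\<rbrakk>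
    \<Longrightarrow> Src C (inv_ar C (phi C g h X)) = act C g \<bullet>\<^sub>o act C h \<bullet>\<^sub>o X"
  and inv_phi_Tgt [simp]: "\<lbrakk>g \<in> carrier G; h \<in> carrier G; X \<in> Ob C\<rbrakk>
    \<Longrightarrow> Tgt C (inv_ar C (phi C g h X)) = act C (g \<otimes>\<^bsub>G\<^esub> h) \<bullet>\<^sub>o X"
  and inv_phi_phi [simp]: "\<lbrakk>g \<in> carrier G; h \<in> carrier G; X \<in> Ob C\<rbrakk>
    \<Longrightarrow> inv_ar C (phi C g h X) \<cdot>\<^bsub>C\<^esub> phi C g h X = Idn C (act C (g \<otimes>\<^bsub>G\<^esub> h) \<bullet>\<^sub>o X)"
  and phi_inv_phi [simp]: "\<lbrakk>g \<in> carrier G; h \<in> carrier G; X \<in> Ob C\<rbrakk>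
    \<Longrightarrow> phi C g h X \<cdot>\<^bsub>C\<^esub> inv_ar C (phi C g h X) = Idn C (act C g \<bullet>\<^sub>o act C h \<bullet>\<^sub>o X)"
  using inv_ar[OF phi_Iso[of g h X]] by (auto simp: Hom_def)

text \<open>The coherence axiom \<open>\<phi>(x, y) \<phi>(xy, z) = x\<^sub>*(\<phi>(y, z)) \<phi>(x, yz)\<close> with \<open>\<phi>(xy, z)\<close> and the whole
  right-hand side inverted is the cocycle condition of the orbit.\<close>

lemma orbit_Ob [simp]:
  assumes X [simp]: "X \<in> Ob C"
  shows "orbit_ob G C X \<in> CG_Ob G C"
proof (rule CG_ObI)
  fix x y z assume [simp]: "x \<in> carrier G" "y \<in> carrier G" "z \<in> carrier G"
  let ?t = "(act C x \<bullet>\<^sub>a phi C y z X) \<cdot>\<^bsub>C\<^esub> phi C x (y \<otimes>\<^bsub>G\<^esub> z) X"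
  let ?t' = "inv_ar C (phi C x (y \<otimes>\<^bsub>G\<^esub> z) X) \<cdot>\<^bsub>C\<^esub> (act C x \<bullet>\<^sub>a inv_ar C (phi C y z X))"
  have "?t' \<cdot>\<^bsub>C\<^esub> ?t = inv_ar C (phi C x (y \<otimes>\<^bsub>G\<^esub> z) X) \<cdot>\<^bsub>C\<^esub>
      ((act C x \<bullet>\<^sub>a (inv_ar C (phi C y z X) \<cdot>\<^bsub>C\<^esub> phi C y z X)) \<cdot>\<^bsub>C\<^esub> phi C x (y \<otimes>\<^bsub>G\<^esub> z) X)"
    by (simp add: Cmp_assoc_Ar act_Cmp del: inv_phi_phi)
  also have "\<dots> = Idn C (act C (x \<otimes>\<^bsub>G\<^esub> y \<otimes>\<^bsub>G\<^esub> z) \<bullet>\<^sub>o X)"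
    by (simp add: m_assoc)
  finally have t': "?t' \<cdot>\<^bsub>C\<^esub> ?t = Idn C (act C (x \<otimes>\<^bsub>G\<^esub> y \<otimes>\<^bsub>G\<^esub> z) \<bullet>\<^sub>o X)" .
  \<comment> \<open>the axiom is read as a square whose fourth side is an identity\<close>
  have "?t' \<cdot>\<^bsub>C\<^esub> phi C x y (act C z \<bullet>\<^sub>o X)
      = Idn C (act C (x \<otimes>\<^bsub>G\<^esub> y \<otimes>\<^bsub>G\<^esub> z) \<bullet>\<^sub>o X) \<cdot>\<^bsub>C\<^esub> inv_ar C (phi C (x \<otimes>\<^bsub>G\<^esub> y) z X)"
  proof (rule square_invert)
    show "?t \<cdot>\<^bsub>C\<^esub> Idn C (act C (x \<otimes>\<^bsub>G\<^esub> y \<otimes>\<^bsub>G\<^esub> z) \<bullet>\<^sub>o X)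
        = phi C x y (act C z \<bullet>\<^sub>o X) \<cdot>\<^bsub>C\<^esub> phi C (x \<otimes>\<^bsub>G\<^esub> y) z X"
      by (simp add: phi_phi m_assoc)
    show "?t' \<cdot>\<^bsub>C\<^esub> ?t = Idn C (act C (x \<otimes>\<^bsub>G\<^esub> y \<otimes>\<^bsub>G\<^esub> z) \<bullet>\<^sub>o X)"
      by (rule t')
  qed (simp_all add: Hom_def m_assoc)
  then show "snd (orbit_ob G C X) (x \<otimes>\<^bsub>G\<^esub> y, z) = snd (orbit_ob G C X) (x, y \<otimes>\<^bsub>G\<^esub> z) \<cdot>\<^bsub>C\<^esub>
      ((act C x \<bullet>\<^sub>a snd (orbit_ob G C X) (y, z)) \<cdot>\<^bsub>C\<^esub> phi C x y (fst (orbit_ob G C X) z))"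
    by (simp add: Cmp_assoc_Ar m_assoc)
qed (simp_all add: inv_ar_Iso phi_Iso)

lemma orbit_Ar [simp]:
  assumes f [simp]: "f \<in> Ar C"
  shows "orbit_ar G C f \<in> CG_Ar G C"
proof (rule CG_ArI)
  fix x y assume [simp]: "x \<in> carrier G" "y \<in> carrier G"
  have "inv_ar C (phi C x y (Tgt C f)) \<cdot>\<^bsub>C\<^esub> (act C x \<bullet>\<^sub>a act C y \<bullet>\<^sub>a f)
      = (act C (x \<otimes>\<^bsub>G\<^esub> y) \<bullet>\<^sub>a f) \<cdot>\<^bsub>C\<^esub> inv_ar C (phi C x y (Src C f))"
  proof (rule square_invert)
    show "phi C x y (Tgt C f) \<cdot>\<^bsub>C\<^esub> (act C (x \<otimes>\<^bsub>G\<^esub> y) \<bullet>\<^sub>a f)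
        = (act C x \<bullet>\<^sub>a act C y \<bullet>\<^sub>a f) \<cdot>\<^bsub>C\<^esub> phi C x y (Src C f)"
      by (rule phi_natural) (simp_all add: Hom_def)
  qed (simp_all add: Hom_def)
  then show "snd (snd (orbit_ar G C f)) (x \<otimes>\<^bsub>G\<^esub> y) \<cdot>\<^bsub>C\<^esub> snd (fst (orbit_ar G C f)) (x, y)
      = snd (fst (snd (orbit_ar G C f))) (x, y) \<cdot>\<^bsub>C\<^esub> (act C x \<bullet>\<^sub>a snd (snd (orbit_ar G C f)) y)"
    by simp
qed (simp_all add: Hom_def)

lemma orbit_functor: "cat_functor C (CG G C) (orbit G C)"
  by (intro cat_functor.intro cat_functor_axioms.intro CG_category category_axioms)
    (auto simp: Hom_def act_Cmp intro!: CG_Ar_eqI[of _ G C])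

text \<open>The condition on arrows at \<open>(x, y)\<close> is the cocycle condition of \<open>X\<close> at \<open>(x, y, e)\<close>, with \<open>\<phi>\<close>
  moved to the other side.\<close>

lemma orbit_to_family_Ar [simp]:
  assumes X [simp]: "X \<in> CG_Ob G C"
  shows "orbit_to_family G C X \<in> CG_Ar G C"
proof (rule CG_ArI)
  fix x y assume [simp]: "x \<in> carrier G" "y \<in> carrier G"
  have "snd X (x \<otimes>\<^bsub>G\<^esub> y, \<one>\<^bsub>G\<^esub>) \<cdot>\<^bsub>C\<^esub> inv_ar C (phi C x y (fst X \<one>\<^bsub>G\<^esub>))
      = (snd X (x, y) \<cdot>\<^bsub>C\<^esub> (act C x \<bullet>\<^sub>a snd X (y, \<one>\<^bsub>G\<^esub>))) \<cdot>\<^bsub>C\<^esub>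
        (phi C x y (fst X \<one>\<^bsub>G\<^esub>) \<cdot>\<^bsub>C\<^esub> inv_ar C (phi C x y (fst X \<one>\<^bsub>G\<^esub>)))"
    by (simp add: CG_iso_mult Cmp_assoc_Ar del: phi_inv_phi)
  also have "\<dots> = snd X (x, y) \<cdot>\<^bsub>C\<^esub> (act C x \<bullet>\<^sub>a snd X (y, \<one>\<^bsub>G\<^esub>))"
    by simp
  finally show "snd (snd (orbit_to_family G C X)) (x \<otimes>\<^bsub>G\<^esub> y) \<cdot>\<^bsub>C\<^esub>
        snd (fst (orbit_to_family G C X)) (x, y)
      = snd (fst (snd (orbit_to_family G C X))) (x, y) \<cdot>\<^bsub>C\<^esub>
        (act C x \<bullet>\<^sub>a snd (snd (orbit_to_family G C X)) y)"
    by simp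
qed (simp_all add: Hom_def)

lemma orbit_to_family_nat_iso:
  "nat_iso (CG G C) (CG G C) (fctr_comp (orbit G C) (U_e G C)) Id_fctr (orbit_to_family G C)"
proof (intro nat_iso.intro nat_iso_axioms.intro nat_trans.intro nat_trans_axioms.intro
    cat_functor_comp[OF U_e_functor orbit_functor])
  show "cat_functor (CG G C) (CG G C) Id_fctr"
    by (intro cat_functor.intro cat_functor_axioms.intro CG_category) (auto simp: Id_fctr_def)
next
  fix X assume "X \<in> Ob (CG G C)"
  then have X [simp]: "X \<in> CG_Ob G C" by simp
  show "orbit_to_family G C X
      \<in> Iso (CG G C) (fctr_comp (orbit G C) (U_e G C) \<bullet>\<^sub>o X) (Id_fctr \<bullet>\<^sub>o X)"
    using CG_IsoI[of "orbit_to_family G C X"] CG_iso_Iso[of X _ "\<one>\<^bsub>G\<^esub>"]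
    by (simp add: fctr_comp_def Id_fctr_def)
  then show "orbit_to_family G C X
      \<in> Hom (CG G C) (fctr_comp (orbit G C) (U_e G C) \<bullet>\<^sub>o X) (Id_fctr \<bullet>\<^sub>o X)"
    by (rule category.Iso_Hom[OF CG_category])
next
  fix f X Y assume "f \<in> Hom (CG G C) X Y"
  then have [simp]: "f \<in> CG_Ar G C" "fst f = X" "fst (snd f) = Y"
    by (auto simp: Hom_def)
  have [simp]: "X \<in> CG_Ob G C" "Y \<in> CG_Ob G C"
    using CG_Src[of f] CG_Tgt[of f] by simp_all
  show "orbit_to_family G C Y \<cdot>\<^bsub>CG G C\<^esub> (fctr_comp (orbit G C) (U_e G C) \<bullet>\<^sub>a f)
      = (Id_fctr \<bullet>\<^sub>a f) \<cdot>\<^bsub>CG G C\<^esub> orbit_to_family G C X"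
    using CG_fam_natural[of f _ "\<one>\<^bsub>G\<^esub>"]
    by (auto simp: fctr_comp_def Id_fctr_def intro!: CG_Ar_eqI[of _ G C])
qed

text \<open>The composite is the identity functor on the nose, as \<open>e\<^sub>*\<close> is.\<close>

lemma U_e_orbit_nat_iso: "nat_iso C C (fctr_comp (U_e G C) (orbit G C)) Id_fctr (Idn C)"
proof (intro nat_iso.intro nat_iso_axioms.intro nat_trans.intro nat_trans_axioms.intro
    cat_functor_comp[OF orbit_functor U_e_functor])
  show "cat_functor C C Id_fctr"
    by (intro cat_functor.intro cat_functor_axioms.intro category_axioms) (auto simp: Id_fctr_def)
qed (auto simp: fctr_comp_def Id_fctr_def Hom_def Iso_Idn)

lemma U_e_equivalence: "cat_equivalence (CG G C) C (U_e G C)"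
  unfolding cat_equivalence_def
  using U_e_functor orbit_functor orbit_to_family_nat_iso U_e_orbit_nat_iso by blast

end

theorem theorem4p3:
  fixes G :: "('g, 'b) monoid_scheme" and C :: "('o, 'm, 'g, 'z) gcat_scheme"
  assumes "group G" and "monoidal_G_category G C"
  shows "strict_monoidal_G_category G (CG G C) \<and>
    strict_monoidal_functor (CG G C) C (U_e G C) \<and>
    monoidal_G_equivalence G (CG G C) C (U_e G C) (gamma G)"
proof -
  interpret C: monoidal_G_category G C by fact
  show ?thesis
    by (intro conjI C.CG_strict_monoidal_G_category C.U_e_strict_monoidal_functor
        monoidal_G_equivalence.intro monoidal_G_equivalence_axioms.intro
        C.U_e_monoidal_G_functor C.U_e_equivalence)
qed

end
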